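(* Let $\mathcal{S}$ be a cut and project scheme with internal space isomorphic to $\mathbb{R}^n\oplus G\oplus\mathbb{Z}^r$, where $G$ is a finite Abelian group and $r\in\mathbb{N}\cup\{0\}$. Then there is another cut and project scheme, with internal space $\mathbb{R}^n$, which produces cut and project sets that are MLD to those of $\mathcal{S}$.
   Context: In this statement a cut and project scheme consists of: a total space $\mathbb{E}\cong\mathbb{R}^k\oplus G\oplus\mathbb{Z}^r$ ($G$ finite Abelian, $r\ge 0$; in the case of internal space $\mathbb{R}^n$, $G$ is trivial and $r=0$); a closed subgroup $\mathbb{E}_\vee\cong\mathbb{R}^d$ (physical space) and a closed subgroup $\mathbb{E}_<\cong\mathbb{R}^n\oplus G\oplus\mathbb{Z}^r$ (internal space), $k=d+n$, with $\mathbb{E}_\vee\cap\mathbb{E}_<=\{0\}$ and $\mathbb{E}=\mathbb{E}_\vee+\mathbb{E}_<$; a lattice (discrete co-compact subgroup) $\Gamma<\mathbb{E}$; and a window $W\subset\mathbb{E}_<$ which is (non-empty,) compact and equal to the closure of its interior. The window may be coloured: $W=\bigcup_i W_i$ is a finite union of compact sets, each the closure of its interior, with distinct $W_i$ intersecting at most on their boundaries. $W$ need not be polytopal. The canonical projections are written $x\mapsto x_\vee\in\mathbb{E}_\vee$, $x\mapsto x_<\in\mathbb{E}_<$. Standing assumptions: both projections are injective on $\Gamma$, $\Gamma_<$ is dense in $\mathbb{E}_<$, and the scheme is non-singular: $\gamma_<\notin\partial W$ (resp. $\gamma_<\notin\partial W_i$ for all $i$) for all $\gamma\in\Gamma$.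 The cut and project set is $\Lambda=\{\gamma_\vee:\gamma\in\Gamma,\ \gamma_<\in W\}\subset\mathbb{E}_\vee$, where $\gamma_\vee$ has colour $i$ if $\gamma_<\in W_i$ in the coloured case. MLD. For (possibly coloured) point sets $\Lambda,\Lambda'$ in $\mathbb{R}^d$, $\Lambda'$ is locally derivable from $\Lambda$ if there is $R>0$ such that for all $x,y\in\mathbb{R}^d$, $(\Lambda-x)\cap B_R=(\Lambda-y)\cap B_R$ (as coloured sets) implies $(\Lambda'-x)\cap\{0\}=(\Lambda'-y)\cap\{0\}$ (as coloured sets). $\Lambda$ and $\Lambda'$ are MLD (mutually locally derivable) if each is locally derivable from the other. *)

theory Defs
  imports "HOL-Analysis.Analysis" "HOL-Library.Function_Algebras"
begin

text \<open>
  Groups are additive subgroups of types of class \<^class>\<open>ab_group_add\<close>, and their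
  topologies are abstract topologies whose \<^const>\<open>topspace\<close> is the group. The space
  \<open>\<real>\<^sup>n\<close>, for \<open>n\<close> a natural number (possibly 0), is the library's
  \<^term>\<open>Euclidean_space n\<close>, that is the functions \<open>nat \<Rightarrow> real\<close> vanishing from
  index \<open>n\<close> on, with pointwise addition.
\<close>

definition add_subgroup :: "'a::ab_group_add set \<Rightarrow> bool" where
  "add_subgroup H \<longleftrightarrow> 0 \<in> H \<and> (\<forall>x\<in>H. \<forall>y\<in>H. x + y \<in> H) \<and> (\<forall>x\<in>H. - x \<in> H)"

definition top_group_iso ::
    "'a::ab_group_add topology \<Rightarrow> 'b::ab_group_add topology \<Rightarrow> ('a \<Rightarrow> 'b) \<Rightarrow> bool" where
  "top_group_iso X Y f \<longleftrightarrow>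
     add_subgroup (topspace X) \<and> add_subgroup (topspace Y) \<and> homeomorphic_map X Y f \<and>
     (\<forall>x\<in>topspace X. \<forall>y\<in>topspace X. f (x + y) = f x + f y)"

definition top_group_isomorphic ::
    "'a::ab_group_add topology \<Rightarrow> 'b::ab_group_add topology \<Rightarrow> bool" where
  "top_group_isomorphic X Y \<longleftrightarrow> (\<exists>f. top_group_iso X Y f)"

text \<open>The topological group \<open>\<real>\<^sup>m \<oplus> G \<oplus> \<int>\<^sup>r\<close>, with \<open>G\<close> and \<open>\<int>\<^sup>r\<close> discrete.\<close>

definition model_space ::
    "nat \<Rightarrow> 'g::ab_group_add set \<Rightarrow> nat \<Rightarrow> ((nat \<Rightarrow> real) \<times> 'g \<times> (nat \<Rightarrow> int)) topology" where
  "model_space m G r =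
     prod_topology (Euclidean_space m)
       (prod_topology (discrete_topology G) (discrete_topology {z. \<forall>i\<ge>r. z i = 0}))"

text \<open>
  A lattice in the group \<open>topspace X\<close> is a discrete subgroup whose quotient is compact. The
  space \<open>Q\<close> below, whose points are the cosets, is determined by the quotient map condition.
\<close>

definition discrete_cocompact_subgroup :: "'a::ab_group_add topology \<Rightarrow> 'a set \<Rightarrow> bool" where
  "discrete_cocompact_subgroup X \<Gamma> \<longleftrightarrow>
     \<Gamma> \<subseteq> topspace X \<and> add_subgroup \<Gamma> \<and>
     subtopology X \<Gamma> = discrete_topology \<Gamma> \<and>
     (\<exists>Q. quotient_map X Q (\<lambda>x. (\<lambda>\<gamma>. x + \<gamma>) ` \<Gamma>) \<and> compact_space Q)"

text \<open>
  The total space is the group \<open>topspace (total S)\<close>. The map \<open>coord\<close> is the identification of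
  the physical space with \<open>\<real>\<^sup>d\<close> through which cut and project sets are regarded as point sets
  in \<open>\<real>\<^sup>d\<close>. The coloured window is the family \<open>window i\<close>, for \<open>i\<close> in the finite set
  \<open>colours\<close>; the uncoloured case is that of a single colour.
\<close>

record ('a, 'c) cut_project =
  total :: "'a topology"
  phys :: "'a set"
  intern :: "'a set"
  lattice :: "'a set"
  coord :: "'a \<Rightarrow> nat \<Rightarrow> real"
  colours :: "'c set"
  window :: "'c \<Rightarrow> 'a set"

definition proj_phys :: "('a::ab_group_add, 'c) cut_project \<Rightarrow> 'a \<Rightarrow> 'a" where
  "proj_phys S x = (THE v. v \<in> phys S \<and> (\<exists>w\<in>intern S. x = v + w))"

definition proj_int :: "('a::ab_group_add, 'c) cut_project \<Rightarrow> 'a \<Rightarrow> 'a" where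
  "proj_int S x = (THE w. w \<in> intern S \<and> (\<exists>v\<in>phys S. x = v + w))"

abbreviation phys_top :: "('a, 'c) cut_project \<Rightarrow> 'a topology" where
  "phys_top S \<equiv> subtopology (total S) (phys S)"

abbreviation int_top :: "('a, 'c) cut_project \<Rightarrow> 'a topology" where
  "int_top S \<equiv> subtopology (total S) (intern S)"

definition admissible_window :: "('a, 'c) cut_project \<Rightarrow> bool" where
  "admissible_window S \<longleftrightarrow>
     finite (colours S) \<and> (\<Union>i\<in>colours S. window S i) \<noteq> {} \<and>
     (\<forall>i\<in>colours S. compactin (int_top S) (window S i) \<and>
        window S i = int_top S closure_of (int_top S interior_of window S i)) \<and>
     (\<forall>i\<in>colours S. \<forall>j\<in>colours S. i \<noteq> j \<longrightarrow>
        window S i \<inter> window S j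
          \<subseteq> int_top S frontier_of window S i \<inter> int_top S frontier_of window S j)"

text \<open>
  A scheme with physical space \<open>\<real>\<^sup>d\<close> and internal space \<open>\<real>\<^sup>n \<oplus> G \<oplus> \<int>\<^sup>r\<close>, including the
  standing assumptions of injectivity, density and non-singularity.
\<close>

definition cut_project_scheme ::
    "nat \<Rightarrow> nat \<Rightarrow> 'g::ab_group_add set \<Rightarrow> nat \<Rightarrow> ('a::ab_group_add, 'c) cut_project \<Rightarrow> bool" where
  "cut_project_scheme d n G r S \<longleftrightarrow>
     finite G \<and> add_subgroup G \<and>
     top_group_isomorphic (total S) (model_space (d + n) G r) \<and>
     add_subgroup (phys S) \<and> closedin (total S) (phys S) \<and>
     top_group_iso (phys_top S) (Euclidean_space d) (coord S) \<and>
     add_subgroup (intern S) \<and> closedin (total S) (intern S) \<and>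
     top_group_isomorphic (int_top S) (model_space n G r) \<and>
     phys S \<inter> intern S = {0} \<and>
     topspace (total S) = {v + w | v w. v \<in> phys S \<and> w \<in> intern S} \<and>
     discrete_cocompact_subgroup (total S) (lattice S) \<and>
     admissible_window S \<and>
     inj_on (proj_phys S) (lattice S) \<and> inj_on (proj_int S) (lattice S) \<and>
     int_top S closure_of (proj_int S ` lattice S) = intern S \<and>
     (\<forall>\<gamma>\<in>lattice S. \<forall>i\<in>colours S. proj_int S \<gamma> \<notin> int_top S frontier_of window S i)"

text \<open>
  Coloured point sets are sets of pairs of a point and its colour. Under the non-singularity
  assumption, every point of a cut and project set has exactly one colour.
\<close>

definition cut_project_set ::
    "('a::ab_group_add, 'c) cut_project \<Rightarrow> ((nat \<Rightarrow> real) \<times> 'c) set" where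
  "cut_project_set S =
     {(coord S (proj_phys S \<gamma>), i) | \<gamma> i.
        \<gamma> \<in> lattice S \<and> i \<in> colours S \<and> proj_int S \<gamma> \<in> window S i}"

definition translate_by :: "((nat \<Rightarrow> real) \<times> 'c) set \<Rightarrow> (nat \<Rightarrow> real) \<Rightarrow> ((nat \<Rightarrow> real) \<times> 'c) set" where
  "translate_by A x = (\<lambda>(p, c). (p - x, c)) ` A"

definition restrict_to :: "((nat \<Rightarrow> real) \<times> 'c) set \<Rightarrow> (nat \<Rightarrow> real) set \<Rightarrow> ((nat \<Rightarrow> real) \<times> 'c) set" where
  "restrict_to A B = {(p, c) \<in> A. p \<in> B}"

definition ball0 :: "nat \<Rightarrow> real \<Rightarrow> (nat \<Rightarrow> real) set" where
  "ball0 d R = {x \<in> topspace (Euclidean_space d). L2_set x {..<d} \<le> R}"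

definition locally_derivable_from ::
    "nat \<Rightarrow> ((nat \<Rightarrow> real) \<times> 'b) set \<Rightarrow> ((nat \<Rightarrow> real) \<times> 'c) set \<Rightarrow> bool" where
  "locally_derivable_from d B A \<longleftrightarrow>
     (\<exists>R>0. \<forall>x\<in>topspace (Euclidean_space d). \<forall>y\<in>topspace (Euclidean_space d).
        restrict_to (translate_by A x) (ball0 d R) = restrict_to (translate_by A y) (ball0 d R) \<longrightarrow>
        restrict_to (translate_by B x) {0} = restrict_to (translate_by B y) {0})"

definition MLD ::
    "nat \<Rightarrow> ((nat \<Rightarrow> real) \<times> 'b) set \<Rightarrow> ((nat \<Rightarrow> real) \<times> 'c) set \<Rightarrow> bool" where
  "MLD d A B \<longleftrightarrow> locally_derivable_from d B A \<and> locally_derivable_from d A B"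

end

theory Submission
  imports Defs
begin

text \<open>
  Fix a splitting \<open>\<real>\<^sup>n \<times> C\<close> of the internal space, with \<open>C = G \<oplus> \<int>\<^sup>r\<close> discrete, so that a window
  becomes a family of slices in \<open>\<real>\<^sup>n\<close> of which only finitely many are non-empty. Let \<open>\<Sigma>\<close> be the group
  of those \<open>s \<in> C\<close> under which all windows are invariant. It is finite, hence torsion, whereas the
  lattice is torsion free because its physical projection is injective. So the lattice
  points with \<open>C\<close>-coordinate in \<open>\<Sigma>\<close> still project injectively after \<open>C\<close> is forgotten, and they form
  a lattice in \<open>\<real>\<^sup>d \<times> \<real>\<^sup>n\<close>. For each slice choose a lattice point over its component and translate the
  slice by it; the new windows are the cells of the common refinement of the translated slices.

  The old set is derived from the new one by undoing the translations. Conversely one has to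
  recognise locally the component, modulo \<open>\<Sigma>\<close>, from which a point comes. A translation by \<open>(t, s)\<close>
  which preserves all windows has \<open>t = 0\<close> by compactness, and then \<open>s \<in> \<Sigma>\<close>; so by density two points
  of the window whose components differ by \<open>s \<notin> \<Sigma>\<close> are told apart by some lattice vector, and by
  compactness finitely many lattice vectors suffice.
\<close>

subsection \<open>Topological groups and lattices\<close>

text \<open>The new lattice cannot keep only the points with \<open>C\<close>-coordinate 0.
  Components that differ by an element of \<Sigma> carry the same slices, so a local pattern reveals
  the component of a point only modulo \<Sigma>, and no local rule could leave out the points over
  the other elements of \<Sigma>. Hence all of \<Sigma> is kept, and it has to be shown that
  forgetting \<open>C\<close> over \<Sigma> destroys neither injectivity nor discreteness. The
  translated slices share one copy of R^n and may overlap, which windows of distinct colours must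
  not do; hence the refinement. A cell records a set of slices, so the new colour at
  \<open>a\<close> lists the pairs \<open>(i, c)\<close> for which \<open>a + \<alpha> c\<close> is
  an old point of colour \<open>i\<close>, where \<open>\<alpha> c\<close> is the physical part of
  the lattice point chosen over \<open>c\<close>. Shifting by lattice points rather than arbitrary
  vectors keeps the new scheme non-singular and makes the shifts visible in physical space. Each
  direction of MLD is then a lookup along finitely many vectors, except that the old pattern must
  also reveal where the new points are.\<close>

lemma add_subgroup_diff: "add_subgroup H \<Longrightarrow> x \<in> H \<Longrightarrow> y \<in> H \<Longrightarrow> x - y \<in> H"
  unfolding add_subgroup_def by (metis diff_conv_add_uminus)

lemma add_subgroupD:
  assumes "add_subgroup H"
  shows "0 \<in> H" "x \<in> H \<Longrightarrow> y \<in> H \<Longrightarrow> x + y \<in> H" "x \<in> H \<Longrightarrow> - x \<in> H"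
    "x \<in> H \<Longrightarrow> y \<in> H \<Longrightarrow> x - y \<in> H"
  using assms add_subgroup_diff[OF assms] unfolding add_subgroup_def by auto

lemma add_subgroup_Times: "add_subgroup A \<Longrightarrow> add_subgroup B \<Longrightarrow> add_subgroup (A \<times> B)"
  unfolding add_subgroup_def by (auto simp: zero_prod_def)

lemma top_group_iso_inverse:
  assumes "top_group_iso X Y f"
  obtains g where "homeomorphic_maps X Y f g"
    "\<And>x y. x \<in> topspace Y \<Longrightarrow> y \<in> topspace Y \<Longrightarrow> g (x + y) = g x + g y"
proof -
  from assms obtain g where g: "homeomorphic_maps X Y f g"
    unfolding top_group_iso_def homeomorphic_map_maps by blast
  have "g (x + y) = g x + g y" if "x \<in> topspace Y" "y \<in> topspace Y" for x y
  proof -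
    have gx: "g x \<in> topspace X" "g y \<in> topspace X" "f (g x) = x" "f (g y) = y"
      using g that by (auto simp: homeomorphic_maps_def continuous_map_def)
    then have "f (g x + g y) = x + y" "g x + g y \<in> topspace X"
      using assms by (auto simp: top_group_iso_def add_subgroup_def)
    then show ?thesis
      using g by (metis homeomorphic_maps_def)
  qed
  with g show thesis using that by blast
qed

lemma additive_on_diff:
  fixes f :: "'a::ab_group_add \<Rightarrow> 'b::ab_group_add"
  assumes "add_subgroup H" "\<And>x y. x \<in> H \<Longrightarrow> y \<in> H \<Longrightarrow> f (x + y) = f x + f y"
    "x \<in> H" "y \<in> H"
  shows "f (x - y) = f x - f y"
  using assms(2)[of "x - y" y] assms add_subgroup_diff[OF assms(1)] by simp

lemma additive_on_0:
  fixes f :: "'a::ab_group_add \<Rightarrow> 'b::ab_group_add"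
  assumes "add_subgroup H" "\<And>x y. x \<in> H \<Longrightarrow> y \<in> H \<Longrightarrow> f (x + y) = f x + f y"
  shows "f 0 = 0"
  using additive_on_diff[OF assms, of 0 0] add_subgroupD(1)[OF assms(1)] by simp

lemma add_subgroup_image:
  fixes f :: "'a::ab_group_add \<Rightarrow> 'b::ab_group_add"
  assumes H: "add_subgroup H" and f: "\<And>x y. x \<in> H \<Longrightarrow> y \<in> H \<Longrightarrow> f (x + y) = f x + f y"
  shows "add_subgroup (f ` H)"
  unfolding add_subgroup_def
proof (intro conjI ballI)
  have f_0: "f 0 = 0" by (rule additive_on_0[OF H f])
  show "0 \<in> f ` H" using imageI[OF add_subgroupD(1)[OF H], of f] unfolding f_0 .
  show "u + v \<in> f ` H" if "u \<in> f ` H" "v \<in> f ` H" for u v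
    using that f add_subgroupD(2)[OF H] by (auto simp: image_iff) metis
  show "- u \<in> f ` H" if "u \<in> f ` H" for u
    using that additive_on_diff[OF H f add_subgroupD(1)[OF H]] add_subgroupD(3)[OF H] f_0
    by (auto simp: image_iff) (metis diff_0)
qed

lemma top_group_isomorphic_sym:
  assumes "top_group_isomorphic X Y" shows "top_group_isomorphic Y X"
proof -
  obtain f where f: "top_group_iso X Y f" using assms by (auto simp: top_group_isomorphic_def)
  obtain g where "homeomorphic_maps X Y f g"
    "\<And>x y. x \<in> topspace Y \<Longrightarrow> y \<in> topspace Y \<Longrightarrow> g (x + y) = g x + g y"
    using top_group_iso_inverse[OF f] by metis
  then have "top_group_iso Y X g"
    using f by (simp add: top_group_iso_def homeomorphic_maps_map)
  then show ?thesis by (auto simp: top_group_isomorphic_def)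
qed

lemma top_group_isomorphic_trans:
  assumes "top_group_isomorphic X Y" "top_group_isomorphic Y Z" shows "top_group_isomorphic X Z"
proof -
  obtain f g where fg: "top_group_iso X Y f" "top_group_iso Y Z g"
    using assms by (auto simp: top_group_isomorphic_def)
  have "f x \<in> topspace Y" if "x \<in> topspace X" for x
    using fg(1) that homeomorphic_imp_surjective_map unfolding top_group_iso_def by blast
  then have "top_group_iso X Z (g \<circ> f)"
    using fg homeomorphic_map_compose[of X Y f Z g] by (simp add: top_group_iso_def)
  then show ?thesis by (auto simp: top_group_isomorphic_def)
qed

text \<open>Continuity of subtraction alone covers both addition and inversion.\<close>

definition topological_group_on :: "'a::ab_group_add topology \<Rightarrow> bool" where
  "topological_group_on X \<longleftrightarrow>
     add_subgroup (topspace X) \<and> continuous_map (prod_topology X X) X (\<lambda>(x, y). x - y)"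

text \<open>A scheme postulates only an isomorphism of its total space with a model, so continuity
  of the group operations has to be transported: subtraction on \<open>X\<close> is
  \<open>g (f x - f y)\<close>.\<close>

lemma topological_group_on_iso:
  assumes "top_group_iso X Y f" "topological_group_on Y"
  shows "topological_group_on X"
proof -
  obtain g where g: "homeomorphic_maps X Y f g"
    "\<And>x y. x \<in> topspace Y \<Longrightarrow> y \<in> topspace Y \<Longrightarrow> g (x + y) = g x + g y"
    using top_group_iso_inverse[OF assms(1)] by metis
  have X: "add_subgroup (topspace X)"
    and f_add: "\<And>x y. x \<in> topspace X \<Longrightarrow> y \<in> topspace X \<Longrightarrow> f (x + y) = f x + f y"
    using assms(1) by (auto simp: top_group_iso_def)
  have cf: "continuous_map X Y f" and cg: "continuous_map Y X g"
    and gf: "\<And>x. x \<in> topspace X \<Longrightarrow> g (f x) = x"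
    using g(1) by (auto simp: homeomorphic_maps_def)
  have "continuous_map (prod_topology X X) (prod_topology Y Y) (\<lambda>(x, y). (f x, f y))"
    using cf by (simp add: continuous_map_prod_top)
  then have "continuous_map (prod_topology X X) X (g \<circ> (\<lambda>(x, y). x - y) \<circ> (\<lambda>(x, y). (f x, f y)))"
    using cg assms(2) unfolding topological_group_on_def
    by (meson continuous_map_compose)
  moreover have "(g \<circ> (\<lambda>(x, y). x - y) \<circ> (\<lambda>(x, y). (f x, f y))) p = (case p of (x, y) \<Rightarrow> x - y)"
    if "p \<in> topspace (prod_topology X X)" for p
    using that additive_on_diff[OF X f_add] gf add_subgroup_diff[OF X] by (force simp: topspace_prod_topology)
  ultimately have "continuous_map (prod_topology X X) X (\<lambda>(x, y). x - y)"
    by (rule continuous_map_eq)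
  then show ?thesis
    using X by (simp add: topological_group_on_def)
qed

lemma topological_group_on_prod:
  assumes "topological_group_on X" "topological_group_on Y"
  shows "topological_group_on (prod_topology X Y)"
proof -
  let ?P = "prod_topology (prod_topology X Y) (prod_topology X Y)"
  have 1: "continuous_map ?P (prod_topology X X) (\<lambda>p. (fst (fst p), fst (snd p)))"
    and 2: "continuous_map ?P (prod_topology Y Y) (\<lambda>p. (snd (fst p), snd (snd p)))"
    using continuous_map_compose[OF continuous_map_fst continuous_map_fst]
      continuous_map_compose[OF continuous_map_fst continuous_map_snd]
      continuous_map_compose[OF continuous_map_snd continuous_map_fst]
      continuous_map_compose[OF continuous_map_snd continuous_map_snd]
    by (auto intro!: continuous_map_pairedI simp: o_def)
  have "continuous_map ?P X ((\<lambda>(x, y). x - y) \<circ> (\<lambda>p. (fst (fst p), fst (snd p))))"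
    "continuous_map ?P Y ((\<lambda>(x, y). x - y) \<circ> (\<lambda>p. (snd (fst p), snd (snd p))))"
    using assms 1 2 unfolding topological_group_on_def by (meson continuous_map_compose)+
  then have "continuous_map ?P (prod_topology X Y)
    (\<lambda>p. (fst (fst p) - fst (snd p), snd (fst p) - snd (snd p)))"
    by (intro continuous_map_pairedI) (auto simp: o_def)
  moreover have "(\<lambda>p. (fst (fst p) - fst (snd p), snd (fst p) - snd (snd p))) = (\<lambda>(x, y). x - (y :: 'a \<times> 'b))"
    by (auto simp: fun_eq_iff)
  ultimately show ?thesis
    using assms add_subgroup_Times unfolding topological_group_on_def by auto
qed

lemma topological_group_on_discrete:
  assumes "add_subgroup H" shows "topological_group_on (discrete_topology H)"
proof -
  have "prod_topology (discrete_topology H) (discrete_topology H) = discrete_topology (H \<times> H)"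
    by (simp add: prod_topology_discrete_topology)
  then show ?thesis
    using assms add_subgroup_diff[OF assms] unfolding topological_group_on_def by auto
qed

lemma add_subgroup_Euclidean_space: "add_subgroup (topspace (Euclidean_space n))"
  by (auto simp: add_subgroup_def topspace_Euclidean_space)

lemma topological_group_on_Euclidean_space: "topological_group_on (Euclidean_space n)"
proof -
  have "continuous_map (prod_topology (Euclidean_space n) (Euclidean_space n)) (Euclidean_space n)
    (\<lambda>p i. fst p i - snd p i)"
    by (intro continuous_map_Euclidean_space_diff continuous_map_fst continuous_map_snd)
  then show ?thesis
    by (simp add: topological_group_on_def add_subgroup_Euclidean_space split_def fun_diff_def)
qed

lemma continuous_map_group_diff:
  assumes "topological_group_on X" "continuous_map Z X f" "continuous_map Z X g"
  shows "continuous_map Z X (\<lambda>z. f z - g z)"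
  using continuous_map_compose[of Z "prod_topology X X" "\<lambda>z. (f z, g z)" X "\<lambda>(x, y). x - y"] assms
  by (simp add: continuous_map_pairedI topological_group_on_def o_def)

lemma continuous_map_group_add:
  assumes "topological_group_on X" "continuous_map Z X f" "continuous_map Z X g"
  shows "continuous_map Z X (\<lambda>z. f z + g z)"
proof -
  have "continuous_map Z X (\<lambda>z. 0)"
    using assms by (auto simp: topological_group_on_def add_subgroup_def)
  then have "continuous_map Z X (\<lambda>z. f z - (0 - g z))"
    using assms by (intro continuous_map_group_diff) auto
  then show ?thesis by simp
qed

section \<open>Translations, discrete subgroups and cocompact subgroups\<close>

lemma homeomorphic_map_translation:
  assumes "topological_group_on X" "v \<in> topspace X"
  shows "homeomorphic_map X X (\<lambda>x. x + v)"
proof -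
  have "continuous_map X X (\<lambda>x. x + v)" "continuous_map X X (\<lambda>x. x - v)"
    using assms by (auto intro!: continuous_map_group_add continuous_map_group_diff
        simp: continuous_map_id[unfolded id_def])
  then have "homeomorphic_maps X X (\<lambda>x. x + v) (\<lambda>x. x - v)"
    by (simp add: homeomorphic_maps_def)
  then show ?thesis using homeomorphic_maps_map by blast
qed

lemma openin_translation:
  assumes "topological_group_on X" "v \<in> topspace X" "openin X U"
  shows "openin X ((\<lambda>x. x + v) ` U)"
  using homeomorphic_map_openness[OF homeomorphic_map_translation[OF assms(1,2)]]
    assms(3) openin_subset by blast

lemma compactin_translation:
  assumes "topological_group_on X" "v \<in> topspace X" "compactin X K"
  shows "compactin X ((\<lambda>x. x + v) ` K)"
  using image_compactin[OF assms(3)] homeomorphic_map_translation[OF assms(1,2)]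
    homeomorphic_imp_continuous_map by blast

text \<open>By homogeneity it is enough to isolate 0: the translate of \<open>U\<close> by
  \<open>v\<close> meets \<Gamma> only in \<open>v\<close>.\<close>

lemma discrete_subgroup_iff:
  assumes "topological_group_on X" "add_subgroup \<Gamma>" "\<Gamma> \<subseteq> topspace X"
  shows "subtopology X \<Gamma> = discrete_topology \<Gamma> \<longleftrightarrow> (\<exists>U. openin X U \<and> 0 \<in> U \<and> U \<inter> \<Gamma> \<subseteq> {0})"
proof
  assume "subtopology X \<Gamma> = discrete_topology \<Gamma>"
  then have "openin (subtopology X \<Gamma>) {0}"
    using assms(2) by (simp add: add_subgroup_def)
  then show "\<exists>U. openin X U \<and> 0 \<in> U \<and> U \<inter> \<Gamma> \<subseteq> {0}"
    by (metis Int_iff insertI1 openin_subtopology subset_refl)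
next
  assume "\<exists>U. openin X U \<and> 0 \<in> U \<and> U \<inter> \<Gamma> \<subseteq> {0}"
  then obtain U where U: "openin X U" "0 \<in> U" "U \<inter> \<Gamma> \<subseteq> {0}" by blast
  have "openin (subtopology X \<Gamma>) {v}" if v: "v \<in> \<Gamma>" for v
  proof -
    have "x = 0" if "x \<in> U" "x + v \<in> \<Gamma>" for x
      using add_subgroup_diff[OF assms(2) that(2) v] that(1) U(3) by auto
    then have "{v} = (\<lambda>x. x + v) ` U \<inter> \<Gamma>"
      using U v by (auto simp: image_iff)
    moreover have "openin X ((\<lambda>x. x + v) ` U)"
      using assms U v by (intro openin_translation) auto
    ultimately show ?thesis
      by (auto simp: openin_subtopology)
  qed
  then show "subtopology X \<Gamma> = discrete_topology \<Gamma>"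
    using assms(3) by (metis discrete_topology_unique topspace_subtopology_subset)
qed

text \<open>A lattice is defined through the existence of a space \<open>Q\<close> of cosets. The
  finest topology on the image that makes \<open>f\<close> continuous provides one.\<close>

lemma quotient_map_exists: "\<exists>Q. quotient_map X Q f"
proof -
  let ?o = "\<lambda>U. U \<subseteq> f ` topspace X \<and> openin X {x \<in> topspace X. f x \<in> U}"
  have "istopology ?o"
    unfolding istopology_def
  proof (intro conjI allI impI)
    fix U V assume UV: "?o U" "?o V"
    have "{x \<in> topspace X. f x \<in> U \<inter> V} = {x \<in> topspace X. f x \<in> U} \<inter> {x \<in> topspace X. f x \<in> V}"
      by auto
    then show "openin X {x \<in> topspace X. f x \<in> U \<inter> V}"
      using UV by auto
    show "U \<inter> V \<subseteq> f ` topspace X" using UV by auto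
  next
    fix \<K> assume K: "\<forall>K\<in>\<K>. ?o K"
    have "{x \<in> topspace X. f x \<in> \<Union>\<K>} = (\<Union>K\<in>\<K>. {x \<in> topspace X. f x \<in> K})" by auto
    then show "openin X {x \<in> topspace X. f x \<in> \<Union>\<K>}"
      using K by auto
    show "\<Union>\<K> \<subseteq> f ` topspace X" using K by auto
  qed
  define T where "T = topology ?o"
  have o: "openin T U \<longleftrightarrow> ?o U" for U
    unfolding T_def topology_inverse'[OF \<open>istopology ?o\<close>] ..
  have "{x \<in> topspace X. f x \<in> f ` topspace X} = topspace X" by auto
  then have "openin T (f ` topspace X)"
    unfolding o by simp
  then have T: "topspace T = f ` topspace X"
    using openin_subset o openin_topspace by (metis subset_antisym)
  have "quotient_map X T f"
    unfolding quotient_map_def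
  proof (intro conjI allI impI)
    show "f ` topspace X = topspace T" using T by simp
    show "openin X {x \<in> topspace X. f x \<in> U} \<longleftrightarrow> openin T U" if "U \<subseteq> topspace T" for U
      using that unfolding o T by blast
  qed
  then show ?thesis ..
qed

text \<open>A point and its translate by an element of \<Gamma> have the same coset, so the
  continuous image of \<open>K\<close> is already the whole quotient.\<close>

lemma cocompactI:
  assumes "add_subgroup \<Gamma>" "compactin X K"
    and cover: "\<And>x. x \<in> topspace X \<Longrightarrow> \<exists>\<gamma>\<in>\<Gamma>. x - \<gamma> \<in> K"
  shows "\<exists>Q. quotient_map X Q (\<lambda>x. (\<lambda>\<gamma>. x + \<gamma>) ` \<Gamma>) \<and> compact_space Q"
proof -
  let ?q = "\<lambda>x. (\<lambda>\<gamma>. x + \<gamma>) ` \<Gamma>"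
  obtain Q where Q: "quotient_map X Q ?q" using quotient_map_exists by blast
  have q: "?q (x - \<gamma>) = ?q x" if "\<gamma> \<in> \<Gamma>" for x \<gamma>
  proof -
    have "(\<lambda>\<delta>. \<delta> - \<gamma>) ` \<Gamma> = \<Gamma>"
      using assms(1) that unfolding image_def add_subgroup_def
      by (auto; metis add_diff_cancel_right' diff_conv_add_uminus)
    then have "?q x = ?q x \<and> ?q (x - \<gamma>) = (\<lambda>\<delta>. x + (\<delta> - \<gamma>)) ` \<Gamma>" by (simp add: algebra_simps)
    also have "(\<lambda>\<delta>. x + (\<delta> - \<gamma>)) ` \<Gamma> = ?q x"
      using \<open>(\<lambda>\<delta>. \<delta> - \<gamma>) ` \<Gamma> = \<Gamma>\<close> by (metis image_image)
    finally show ?thesis by simp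
  qed
  have "topspace Q \<subseteq> ?q ` K"
  proof
    fix y assume "y \<in> topspace Q"
    then obtain x where x: "x \<in> topspace X" "y = ?q x"
      using quotient_imp_surjective_map[OF Q] by blast
    then obtain \<gamma> where "\<gamma> \<in> \<Gamma>" "x - \<gamma> \<in> K" using cover by blast
    then show "y \<in> ?q ` K" using q x by blast
  qed
  moreover have "compactin Q (?q ` K)"
    using image_compactin[OF assms(2)] Q quotient_imp_continuous_map by blast
  ultimately have "compact_space Q"
    by (metis compact_space_def compactin_subset_topspace subset_antisym)
  with Q show ?thesis by blast
qed

text \<open>The quotient map is open, because the saturation of an open set is a union of its
  translates by \<Gamma>. The images of the translates of \<open>U\<close> therefore form an open
  cover of the compact quotient, and \<open>F\<close> collects the shifts of a finite
  subcover.\<close>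

lemma cocompactD:
  assumes "topological_group_on X" "add_subgroup \<Gamma>" "\<Gamma> \<subseteq> topspace X" "quotient_map X Q (\<lambda>x. (\<lambda>\<gamma>. x + \<gamma>) ` \<Gamma>)" "compact_space Q"
    "openin X U" "U \<noteq> {}"
  obtains F where "finite F" "F \<subseteq> topspace X"
    "\<And>x. x \<in> topspace X \<Longrightarrow> \<exists>\<gamma>\<in>\<Gamma>. \<exists>e\<in>F. \<exists>u\<in>U. x = \<gamma> + (u + e)"
proof -
  let ?q = "\<lambda>x. (\<lambda>\<gamma>. x + \<gamma>) ` \<Gamma>"
  let ?U = "\<lambda>e. ?q ` (\<lambda>x. x + e) ` U"
  have eq: "\<exists>\<gamma>\<in>\<Gamma>. x = \<gamma> + y" if "?q x = ?q y" for x y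
  proof -
    have "x \<in> ?q x" using assms(2) by (force simp: add_subgroup_def image_iff)
    with that show ?thesis by (auto simp: add.commute)
  qed
  have X: "add_subgroup (topspace X)" using assms(1) by (simp add: topological_group_on_def)
  have op: "openin Q (?U e)" if e: "e \<in> topspace X" for e
  proof -
    let ?V = "(\<lambda>x. x + e) ` U"
    have V: "openin X ?V" using openin_translation assms(1,6) e by blast
    have "{x \<in> topspace X. ?q x \<in> ?q ` ?V} = (\<Union>\<gamma>\<in>\<Gamma>. (\<lambda>x. x + \<gamma>) ` ?V)"
    proof (intro equalityI subsetI)
      fix x assume "x \<in> {x \<in> topspace X. ?q x \<in> ?q ` ?V}"
      then obtain v where "v \<in> ?V" "?q x = ?q v" by auto
      then obtain \<gamma> where "\<gamma> \<in> \<Gamma>" "x = v + \<gamma>" using eq[of x v] by (auto simp: add.commute)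
      with \<open>v \<in> ?V\<close> show "x \<in> (\<Union>\<gamma>\<in>\<Gamma>. (\<lambda>x. x + \<gamma>) ` ?V)" by blast
    next
      fix x assume "x \<in> (\<Union>\<gamma>\<in>\<Gamma>. (\<lambda>x. x + \<gamma>) ` ?V)"
      then obtain \<gamma> v where v: "\<gamma> \<in> \<Gamma>" "v \<in> ?V" "x = v + \<gamma>" by blast
      have "?q x = ?q v"
      proof -
        have "v + \<gamma> + \<delta> \<in> ?q v" if "\<delta> \<in> \<Gamma>" for \<delta>
          using add_subgroupD(2)[OF assms(2) v(1) that] by (auto simp: add.assoc)
        moreover have "v + \<delta> \<in> ?q (v + \<gamma>)" if "\<delta> \<in> \<Gamma>" for \<delta>
          using add_subgroupD(4)[OF assms(2) that v(1)] by (auto simp: image_iff intro!: bexI[of _ "\<delta> - \<gamma>"])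
        ultimately show ?thesis using v(3) by blast
      qed
      moreover have "x \<in> topspace X"
        using v V[THEN openin_subset] X assms(3) by (auto simp: add_subgroup_def)
      ultimately show "x \<in> {x \<in> topspace X. ?q x \<in> ?q ` ?V}" using v(2) by blast
    qed
    moreover have "openin X (\<Union>\<gamma>\<in>\<Gamma>. (\<lambda>x. x + \<gamma>) ` ?V)"
      using V openin_translation[OF assms(1)] assms(3) by blast
    ultimately have "openin X {x \<in> topspace X. ?q x \<in> ?q ` ?V}" by simp
    moreover have "?q ` ?V \<subseteq> topspace Q"
      using V[THEN openin_subset] quotient_imp_surjective_map[OF assms(4)] by blast
    ultimately show ?thesis using assms(4) unfolding quotient_map_def by blast
  qed
  obtain u where u: "u \<in> U" using assms(7) by blast
  then have uX: "u \<in> topspace X" using assms(6) openin_subset by blast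
  have "topspace Q \<subseteq> \<Union>(?U ` topspace X)"
  proof
    fix y assume "y \<in> topspace Q"
    then obtain x where x: "x \<in> topspace X" "y = ?q x"
      using quotient_imp_surjective_map[OF assms(4)] by blast
    have "x - u \<in> topspace X" using X x(1) uX by (rule add_subgroup_diff)
    moreover have "x \<in> (\<lambda>z. z + (x - u)) ` U" using u by (auto simp: image_iff intro!: bexI[of _ u])
    ultimately show "y \<in> \<Union>(?U ` topspace X)" using x(2) by blast
  qed
  moreover have "openin Q V" if "V \<in> ?U ` topspace X" for V
    using that op by (elim imageE) simp
  moreover have "compactin Q (topspace Q)"
    using assms(5) by (simp add: compact_space_def)
  ultimately have "\<exists>F'. finite F' \<and> F' \<subseteq> ?U ` topspace X \<and> topspace Q \<subseteq> \<Union>F'"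
    by (rule_tac compactinD)
  then obtain F' where F': "finite F'" "F' \<subseteq> ?U ` topspace X" "topspace Q \<subseteq> \<Union>F'"
    by (elim exE conjE)
  obtain F where F: "finite F" "F \<subseteq> topspace X" "F' = ?U ` F"
    using finite_subset_image[OF F'(1,2)] by (elim exE conjE)
  show thesis
  proof (rule that[OF F(1,2)])
    fix x assume "x \<in> topspace X"
    then have "?q x \<in> topspace Q" using quotient_imp_surjective_map[OF assms(4)] by blast
    then have "?q x \<in> \<Union>F'" using F'(3) by (rule rev_subsetD)
    then obtain e u where "e \<in> F" "u \<in> U" "?q x = ?q (u + e)"
      unfolding F(3) by (elim UN_E imageE) simp
    moreover obtain \<gamma> where "\<gamma> \<in> \<Gamma>" "x = \<gamma> + (u + e)" using eq[OF \<open>?q x = ?q (u + e)\<close>] by blast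
    ultimately show "\<exists>\<gamma>\<in>\<Gamma>. \<exists>e\<in>F. \<exists>u\<in>U. x = \<gamma> + (u + e)" by blast
  qed
qed

subsection \<open>Euclidean spaces\<close>

text \<open>With the trivial group and \<open>r = 0\<close> both discrete factors are singletons;
  this is how the R^n of the conclusion appears in the format of \<open>model_space\<close>.\<close>

lemma Euclidean_space_isomorphic_model:
  "top_group_isomorphic (Euclidean_space m) (model_space m {0::int} 0)"
proof -
  have "{z :: nat \<Rightarrow> int. \<forall>i\<ge>0. z i = 0} = {0}" by (auto simp: fun_eq_iff)
  then have M: "model_space m {0::int} 0 =
      prod_topology (Euclidean_space m) (prod_topology (discrete_topology {0}) (discrete_topology {0}))"
    unfolding model_space_def by simp
  have "homeomorphic_maps (Euclidean_space m) (model_space m {0::int} 0) (\<lambda>x. (x, 0, 0)) fst"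
    unfolding M homeomorphic_maps_def
    by (auto intro!: continuous_map_pairedI continuous_map_fst simp: continuous_map_id[unfolded id_def])
  then have "top_group_iso (Euclidean_space m) (model_space m {0::int} 0) (\<lambda>x. (x, 0, 0))"
    using homeomorphic_maps_map unfolding top_group_iso_def
    by (auto simp: M intro!: add_subgroup_Times add_subgroup_Euclidean_space) (auto simp: add_subgroup_def zero_prod_def)
  then show ?thesis by (auto simp: top_group_isomorphic_def)
qed

lemma Hausdorff_Euclidean_space: "Hausdorff_space (Euclidean_space n)"
  using completely_metrizable_Euclidean_space completely_metrizable_imp_metrizable_space
    metrizable_imp_Hausdorff_space by blast

lemma continuous_map_into_Euclidean_space:
  "continuous_map X (Euclidean_space n) f \<longleftrightarrow>
     (\<forall>i. continuous_map X euclideanreal (\<lambda>x. f x i)) \<and> f \<in> topspace X \<rightarrow> topspace (Euclidean_space n)"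
  unfolding Euclidean_space_def continuous_map_in_subtopology
  by (auto simp: continuous_map_componentwise_UNIV)

lemma continuous_map_Euclidean_space_component:
  "continuous_map X (Euclidean_space n) f \<Longrightarrow> continuous_map X euclideanreal (\<lambda>x. f x i)"
  by (simp add: continuous_map_into_Euclidean_space)

text \<open>\<open>Euclidean_space n\<close> is a subspace of a countable power of the reals. The
  box is closed there and lies in a product of compact intervals with factor 0 from index
  \<open>n\<close> on, so Tychonoff's theorem applies.\<close>

lemma compactin_Euclidean_box:
  "compactin (Euclidean_space n) {x \<in> topspace (Euclidean_space n). \<forall>i. \<bar>x i\<bar> \<le> M}"
proof -
  have "compactin (powertop_real UNIV) (PiE UNIV (\<lambda>i. if i < n then {-M..M} else {0}))"
    by (auto simp: compactin_PiE)
  moreover have "closedin (powertop_real UNIV) {x \<in> topspace (Euclidean_space n). \<forall>i. \<bar>x i\<bar> \<le> M}"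
  proof -
    have "(\<forall>i. \<bar>x i\<bar> \<le> M) \<longleftrightarrow> (\<forall>i. - M \<le> x i \<and> x i \<le> M)" for x :: "nat \<Rightarrow> real"
      by (metis abs_le_iff minus_le_iff)
    then have "{x \<in> topspace (Euclidean_space n). \<forall>i. \<bar>x i\<bar> \<le> M} =
      topspace (Euclidean_space n) \<inter> (\<Inter>i. {x \<in> topspace (powertop_real UNIV). x i \<in> {-M..M}})"
      by auto
    moreover have "closedin (powertop_real UNIV) {x \<in> topspace (powertop_real UNIV). x i \<in> {-M..M}}" for i
      by (rule closedin_continuous_map_preimage[where Y = euclideanreal])
        (auto intro: continuous_map_product_projection)
    ultimately show ?thesis
      using closedin_Euclidean_space[of n] by (auto intro!: closedin_Int closedin_INT)
  qed
  moreover have "{x \<in> topspace (Euclidean_space n). \<forall>i. \<bar>x i\<bar> \<le> M}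
      \<subseteq> PiE UNIV (\<lambda>i. if i < n then {-M..M} else {0})"
    by (auto simp: topspace_Euclidean_space PiE_iff) (metis abs_le_iff minus_le_iff)+
  ultimately have "compactin (powertop_real UNIV) {x \<in> topspace (Euclidean_space n). \<forall>i. \<bar>x i\<bar> \<le> M}"
    using closed_compactin by blast
  then show ?thesis
    unfolding Euclidean_space_def by (auto simp: compactin_subtopology)
qed

lemma compactin_Euclidean_bounded:
  assumes "compactin (Euclidean_space n) K"
  shows "\<exists>M. \<forall>x\<in>K. \<bar>x i\<bar> \<le> M"
proof -
  have "compactin euclideanreal ((\<lambda>x. x i) ` K)"
    using assms continuous_map_Euclidean_space_component[OF continuous_map_id, of n i]
    by (intro image_compactin[where X = "Euclidean_space n"]) (auto simp: id_def)
  then have "bounded ((\<lambda>x. x i) ` K)" using compact_imp_bounded by auto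
  then show ?thesis by (auto simp: bounded_iff)
qed

text \<open>Identifies the product of R^d and R^n with R^(d+n). The first factor is embedded by
  inclusion (\<open>join_left\<close>), so the new physical space is
  \<open>Euclidean_space d\<close> itself and needs no further coordinates.\<close>

definition join :: "nat \<Rightarrow> (nat \<Rightarrow> real) \<Rightarrow> (nat \<Rightarrow> real) \<Rightarrow> nat \<Rightarrow> real" where
  "join d a b = (\<lambda>i. if i < d then a i else b (i - d))"

lemma join_add: "join d (a + a') (b + b') = join d a b + join d a' b'"
  and join_diff: "join d (a - a') (b - b') = join d a b - join d a' b'"
  and join_0: "join d 0 0 = 0"
  by (auto simp: join_def)

lemma homeomorphic_maps_join:
  "homeomorphic_maps (prod_topology (Euclidean_space d) (Euclidean_space n)) (Euclidean_space (d + n))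
     (\<lambda>(a, b). join d a b) (\<lambda>x. (\<lambda>i. if i < d then x i else 0, \<lambda>i. x (i + d)))"
proof -
  let ?P = "prod_topology (Euclidean_space d) (Euclidean_space n)"
  have "continuous_map ?P euclideanreal (\<lambda>p. join d (fst p) (snd p) i)" for i
    using continuous_map_Euclidean_space_component[OF continuous_map_fst]
      continuous_map_Euclidean_space_component[OF continuous_map_snd]
    by (cases "i < d") (auto simp: join_def)
  then have 1: "continuous_map ?P (Euclidean_space (d + n)) (\<lambda>(a, b). join d a b)"
    unfolding continuous_map_into_Euclidean_space by (auto simp: split_def join_def topspace_Euclidean_space)
  have 2: "continuous_map (Euclidean_space (d + n)) euclideanreal (\<lambda>x. x i)" for i
    using continuous_map_Euclidean_space_component[OF continuous_map_id] by (simp add: id_def)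
  have "continuous_map (Euclidean_space (d + n)) (Euclidean_space d) (\<lambda>x i. if i < d then x i else 0)"
    by (simp add: continuous_map_componentwise_Euclidean_space 2)
  moreover have "continuous_map (Euclidean_space (d + n)) (Euclidean_space n) (\<lambda>x i. x (i + d))"
    by (auto simp: continuous_map_into_Euclidean_space 2 topspace_Euclidean_space)
  ultimately have "continuous_map (Euclidean_space (d + n)) ?P (\<lambda>x. (\<lambda>i. if i < d then x i else 0, \<lambda>i. x (i + d)))"
    by (rule continuous_map_pairedI)
  with 1 show ?thesis
    by (auto simp: homeomorphic_maps_def topspace_Euclidean_space join_def fun_eq_iff)
qed

lemma join_inject:
  assumes "a \<in> topspace (Euclidean_space d)" "a' \<in> topspace (Euclidean_space d)"
  shows "join d a b = join d a' b' \<longleftrightarrow> a = a' \<and> b = b'"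
proof
  assume eq: "join d a b = join d a' b'"
  have "b i = b' i" for i using fun_cong[OF eq, of "i + d"] by (simp add: join_def)
  moreover have "a i = a' i" for i
    using fun_cong[OF eq, of i] assms by (cases "i < d") (auto simp: join_def topspace_Euclidean_space)
  ultimately show "a = a' \<and> b = b'" by auto
qed simp

lemma join_left: "a \<in> topspace (Euclidean_space d) \<Longrightarrow> join d a 0 = a"
  by (auto simp: join_def topspace_Euclidean_space)

lemma join_split: "a \<in> topspace (Euclidean_space d) \<Longrightarrow> join d a b = a + join d 0 b"
  using join_add[of d a 0 0 b] join_left[of a d] by simp

lemma join_in:
  assumes "a \<in> topspace (Euclidean_space d)" "b \<in> topspace (Euclidean_space n)"
  shows "join d a b \<in> topspace (Euclidean_space (d + n))"
  using assms by (auto simp: join_def topspace_Euclidean_space)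

lemma join_surj:
  assumes "x \<in> topspace (Euclidean_space (d + n))"
  obtains a b where "a \<in> topspace (Euclidean_space d)" "b \<in> topspace (Euclidean_space n)" "x = join d a b"
  using assms by (intro that[of "\<lambda>i. if i < d then x i else 0" "\<lambda>i. x (i + d)"])
    (auto simp: join_def topspace_Euclidean_space)

lemma homeomorphic_map_join_right:
  "homeomorphic_map (Euclidean_space n)
     (subtopology (Euclidean_space (d + n)) (join d 0 ` topspace (Euclidean_space n))) (join d 0)"
proof -
  have c: "continuous_map (Euclidean_space m) euclideanreal (\<lambda>x. x i)" for m i
    using continuous_map_Euclidean_space_component[OF continuous_map_id] by (simp add: id_def)
  have "continuous_map (Euclidean_space n) euclideanreal (\<lambda>x. join d 0 x i)" for i
    by (cases "i < d") (simp_all add: join_def c)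
  then have "continuous_map (Euclidean_space n) (Euclidean_space (d + n)) (join d 0)"
    unfolding continuous_map_into_Euclidean_space by (auto simp: join_def topspace_Euclidean_space)
  moreover have "continuous_map (Euclidean_space (d + n)) (Euclidean_space n) (\<lambda>x i. x (i + d))"
    by (auto simp: continuous_map_into_Euclidean_space c topspace_Euclidean_space)
  ultimately have "homeomorphic_maps (Euclidean_space n)
     (subtopology (Euclidean_space (d + n)) (join d 0 ` topspace (Euclidean_space n))) (join d 0) (\<lambda>x i. x (i + d))"
    by (auto simp: homeomorphic_maps_def continuous_map_in_subtopology continuous_map_from_subtopology join_def)
  then show ?thesis using homeomorphic_maps_map by blast
qed

subsection \<open>Common refinements of windows\<close>

text \<open>For closed slices, interiors on \<open>A\<close> and complements off \<open>A\<close>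
  are open conditions. A frontier point of a slice satisfies neither of them and belongs to no such
  set.\<close>

definition overlay_open :: "'a topology \<Rightarrow> ('j \<Rightarrow> 'a set) \<Rightarrow> 'j set \<Rightarrow> 'j set \<Rightarrow> 'a set" where
  "overlay_open X U J A =
     {x \<in> topspace X. (\<forall>j\<in>A. x \<in> X interior_of U j) \<and> (\<forall>j\<in>J - A. x \<notin> U j)}"

definition overlay_cell :: "'a topology \<Rightarrow> ('j \<Rightarrow> 'a set) \<Rightarrow> 'j set \<Rightarrow> 'j set \<Rightarrow> 'a set" where
  "overlay_cell X U J A = X closure_of overlay_open X U J A"

lemma openin_overlay_open:
  assumes "finite J" "A \<subseteq> J" "\<And>j. j \<in> J \<Longrightarrow> closedin X (U j)"
  shows "openin X (overlay_open X U J A)"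
proof -
  have "overlay_open X U J A =
      topspace X \<inter> \<Inter>((\<lambda>j. X interior_of U j) ` A) \<inter> (topspace X - \<Union>(U ` (J - A)))"
    unfolding overlay_open_def by auto
  moreover have "openin X (topspace X \<inter> \<Inter>((\<lambda>j. X interior_of U j) ` A))"
    using finite_subset[OF assms(2,1)] by (intro openin_Int_Inter) auto
  moreover have "closedin X (\<Union>(U ` (J - A)))"
    using assms by (intro closedin_Union) auto
  ultimately show ?thesis by auto
qed

text \<open>The source of the requirement that each new window be the closure of its
  interior.\<close>

lemma closure_of_interior_of_closure_of_open:
  assumes "openin X O'"
  shows "X closure_of (X interior_of (X closure_of O')) = X closure_of O'"
proof
  show "X closure_of (X interior_of (X closure_of O')) \<subseteq> X closure_of O'"
    by (intro closure_of_minimal interior_of_subset) simp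
  have "O' \<subseteq> X interior_of (X closure_of O')"
    by (intro interior_of_maximal closure_of_subset openin_subset assms)
  then show "X closure_of O' \<subseteq> X closure_of (X interior_of (X closure_of O'))"
    by (rule closure_of_mono)
qed

text \<open>An open set that misses a set also misses its closure. This is used twice, first for
  \<open>Q\<close> against the closure of \<open>P\<close>, then for the interior of that closure
  against the closure of \<open>Q\<close>.\<close>

lemma interior_of_closure_of_disjoint_open:
  assumes "openin X P" "openin X Q" "P \<inter> Q = {}"
  shows "X interior_of (X closure_of P) \<inter> X closure_of Q = {}"
proof -
  have "P \<inter> X closure_of Q = {}"
    using assms openin_Int_closure_of_eq_empty by blast
  have "X interior_of (X closure_of P) \<inter> Q = {}"
    using assms openin_Int_closure_of_eq_empty[OF assms(2), of P] interior_of_subset[of X "X closure_of P"]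
    by blast
  then show ?thesis
    by (simp add: openin_Int_closure_of_eq_empty)
qed

context
  fixes X :: "'a topology" and U :: "'j \<Rightarrow> 'a set" and J :: "'j set"
  assumes finite_J: "finite J" and closed_U: "\<And>j. j \<in> J \<Longrightarrow> closedin X (U j)"
begin

lemma overlay_cell_regular:
  assumes "A \<subseteq> J"
  shows "overlay_cell X U J A = X closure_of (X interior_of overlay_cell X U J A)"
  unfolding overlay_cell_def
  using closure_of_interior_of_closure_of_open[OF openin_overlay_open[OF finite_J assms closed_U]]
  by simp

lemma overlay_cell_subset:
  assumes "A \<subseteq> J" "j \<in> A"
  shows "overlay_cell X U J A \<subseteq> U j"
  unfolding overlay_cell_def
proof (rule closure_of_minimal)
  show "overlay_open X U J A \<subseteq> U j"
    using assms interior_of_subset[of X "U j"] by (auto simp: overlay_open_def)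
  show "closedin X (U j)" using assms closed_U by blast
qed

lemma overlay_open_disjoint:
  assumes "A \<subseteq> J" "B \<subseteq> J" "A \<noteq> B"
  shows "overlay_open X U J A \<inter> overlay_open X U J B = {}"
proof -
  have "A \<subseteq> B" if "x \<in> overlay_open X U J A" "x \<in> overlay_open X U J B" "A \<subseteq> J" for x A B
    using that interior_of_subset[of X] unfolding overlay_open_def by blast
  then show ?thesis using assms by blast
qed

text \<open>Cells are closures of disjoint open sets, so the interior of either one misses the
  other, and a common point can only be a frontier point of both.\<close>

lemma overlay_cell_Int:
  assumes "A \<subseteq> J" "B \<subseteq> J" "A \<noteq> B"
  shows "overlay_cell X U J A \<inter> overlay_cell X U J B
    \<subseteq> X frontier_of overlay_cell X U J A \<inter> X frontier_of overlay_cell X U J B"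
proof -
  note op = openin_overlay_open[OF finite_J _ closed_U]
  have "X interior_of overlay_cell X U J A \<inter> overlay_cell X U J B = {}"
    "X interior_of overlay_cell X U J B \<inter> overlay_cell X U J A = {}"
    unfolding overlay_cell_def
    using assms overlay_open_disjoint[OF assms] overlay_open_disjoint[OF assms(2,1)]
    by (intro interior_of_closure_of_disjoint_open op; auto)+
  moreover have "X closure_of overlay_cell X U J A = overlay_cell X U J A" for A
    by (simp add: overlay_cell_def)
  ultimately show ?thesis unfolding frontier_of_def by auto
qed

text \<open>A point off all frontiers lies in the open core of the cell indexed by the slices that
  contain it. This core is disjoint from the other cores, hence from all other cells.\<close>

lemma
  assumes x: "x \<in> topspace X" "\<And>j. j \<in> J \<Longrightarrow> x \<notin> X frontier_of U j" and A: "A \<subseteq> J"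
  shows generic_in_overlay_cell_iff: "x \<in> overlay_cell X U J A \<longleftrightarrow> A = {j \<in> J. x \<in> U j}"
    and generic_not_in_frontier: "x \<notin> X frontier_of overlay_cell X U J A"
proof -
  let ?A = "{j \<in> J. x \<in> U j}"
  note op = openin_overlay_open[OF finite_J _ closed_U]
  have xo: "x \<in> overlay_open X U J ?A"
    using x closed_U by (auto simp: overlay_open_def frontier_of_def closure_of_closedin)
  have sub: "overlay_open X U J B \<subseteq> overlay_cell X U J B" for B
    unfolding overlay_cell_def by (intro closure_of_subset) (auto simp: overlay_open_def)
  have disj: "x \<notin> overlay_cell X U J A" if "A \<noteq> ?A"
  proof -
    have "openin X (overlay_open X U J ?A)" by (rule op) auto
    moreover have "overlay_open X U J ?A \<inter> overlay_open X U J A = {}"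
      using A that by (intro overlay_open_disjoint) auto
    ultimately have "overlay_open X U J ?A \<inter> overlay_cell X U J A = {}"
      unfolding overlay_cell_def by (simp add: openin_Int_closure_of_eq_empty)
    with xo show ?thesis by blast
  qed
  then show "x \<in> overlay_cell X U J A \<longleftrightarrow> A = ?A"
    using xo sub by blast
  show "x \<notin> X frontier_of overlay_cell X U J A"
  proof (cases "A = ?A")
    case True
    have "overlay_open X U J ?A \<subseteq> X interior_of overlay_cell X U J ?A"
      by (intro interior_of_maximal sub op) auto
    then show ?thesis using xo True by (auto simp: frontier_of_def)
  next
    case False
    then show ?thesis using disj by (auto simp: frontier_of_def overlay_cell_def)
  qed
qed

end

subsection \<open>Separation of the components\<close>

lemma finite_union_of_witnesses:
  assumes "finite S" "\<And>x. x \<in> S \<Longrightarrow> \<exists>F. finite F \<and> F \<subseteq> A \<and> P x F"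
    and "\<And>x F F'. P x F \<Longrightarrow> F \<subseteq> F' \<Longrightarrow> P x F'"
  shows "\<exists>F. finite F \<and> F \<subseteq> A \<and> (\<forall>x\<in>S. P x F)"
proof -
  obtain f where f: "\<And>x. x \<in> S \<Longrightarrow> finite (f x) \<and> f x \<subseteq> A \<and> P x (f x)"
    using assms(2) by metis
  have "P x (\<Union>(f ` S))" if "x \<in> S" for x
    using assms(3)[of x "f x"] f that by blast
  then show ?thesis
    using f assms(1) by (intro exI[of _ "\<Union>(f ` S)"]) auto
qed

text \<open>
  \<^term>\<open>L\<close> is the lattice in coordinates from \<open>\<real>\<^sup>d \<times> \<real>\<^sup>n \<times> C\<close>, and \<^term>\<open>w i c\<close> is the slice of the
  \<open>i\<close>-th window over \<^term>\<open>c\<close>.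
\<close>

locale sliced_scheme =
  fixes d n :: nat and C :: "'k::ab_group_add set"
    and L :: "((nat \<Rightarrow> real) \<times> (nat \<Rightarrow> real) \<times> 'k) set"
    and I :: "'c set" and w :: "'c \<Rightarrow> 'k \<Rightarrow> (nat \<Rightarrow> real) set"
  assumes C_subgroup: "add_subgroup C"
    and L_subgroup: "add_subgroup L"
    and L_subset: "L \<subseteq> topspace (Euclidean_space d) \<times> topspace (Euclidean_space n) \<times> C"
    and L_inj_phys: "(0, b, c) \<in> L \<Longrightarrow> b = 0 \<and> c = 0"
    and L_inj_int: "(a, 0, 0) \<in> L \<Longrightarrow> a = 0"
    and L_dense: "c \<in> C \<Longrightarrow> openin (Euclidean_space n) O' \<Longrightarrow> O' \<noteq> {} \<Longrightarrow> \<exists>a b. (a, b, c) \<in> L \<and> b \<in> O'"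
    and L_discrete: "\<exists>O'. openin (prod_topology (Euclidean_space d) (Euclidean_space n)) O' \<and> (0, 0) \<in> O' \<and>
        (\<forall>a b. (a, b, 0) \<in> L \<and> (a, b) \<in> O' \<longrightarrow> a = 0 \<and> b = 0)"
    and L_cocompact: "\<exists>K F. compactin (prod_topology (Euclidean_space d) (Euclidean_space n)) K \<and> finite F \<and>
        (\<forall>a\<in>topspace (Euclidean_space d). \<forall>b\<in>topspace (Euclidean_space n).
           \<exists>a' b' c'. (a', b', c') \<in> L \<and> (a - a', b - b') \<in> K \<and> c' \<in> F)"
    and finite_I: "finite I"
    and w_compact: "i \<in> I \<Longrightarrow> compactin (Euclidean_space n) (w i c)"
    and w_regular: "i \<in> I \<Longrightarrow> w i c = Euclidean_space n closure_of (Euclidean_space n interior_of w i c)"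
    and w_support: "i \<in> I \<Longrightarrow> w i c \<noteq> {} \<Longrightarrow> c \<in> C"
    and finite_support: "finite {c. \<exists>i\<in>I. w i c \<noteq> {}}"
    and w_nonempty: "\<exists>i\<in>I. \<exists>c. w i c \<noteq> {}"
    and w_nonsingular: "(a, b, c) \<in> L \<Longrightarrow> i \<in> I \<Longrightarrow> b \<notin> Euclidean_space n frontier_of w i c"
begin

text \<open>The group \<Sigma> of the overview.\<close>

definition periods :: "'k set" where
  "periods = {s \<in> C. \<forall>i\<in>I. \<forall>c. w i (c + s) = w i c}"

definition support :: "'k set" where
  "support = {c. \<exists>i\<in>I. w i c \<noteq> {}}"

lemma L_add: "(a, b, c) \<in> L \<Longrightarrow> (a', b', c') \<in> L \<Longrightarrow> (a + a', b + b', c + c') \<in> L"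
  using L_subgroup by (fastforce simp: add_subgroup_def)

lemma L_diff: "(a, b, c) \<in> L \<Longrightarrow> (a', b', c') \<in> L \<Longrightarrow> (a - a', b - b', c - c') \<in> L"
  using add_subgroup_diff[OF L_subgroup] by fastforce

lemma L_0: "(0, 0, 0) \<in> L"
  using L_subgroup by (simp add: add_subgroup_def zero_prod_def)

lemma L_D:
  assumes "(a, b, c) \<in> L"
  shows "a \<in> topspace (Euclidean_space d)" "b \<in> topspace (Euclidean_space n)" "c \<in> C"
  using assms L_subset by auto

lemma L_unique: "(a, b, c) \<in> L \<Longrightarrow> (a, b', c') \<in> L \<Longrightarrow> b = b' \<and> c = c'"
  using L_diff[of a b c a b' c'] L_inj_phys[of "b - b'" "c - c'"] by simp

lemma w_closed: "i \<in> I \<Longrightarrow> closedin (Euclidean_space n) (w i c)"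
  by (metis closedin_closure_of w_regular)

lemma w_subset: "i \<in> I \<Longrightarrow> w i c \<subseteq> topspace (Euclidean_space n)"
  using w_closed closedin_subset by blast

lemma periods_subgroup: "add_subgroup periods"
  unfolding add_subgroup_def
proof (intro conjI ballI)
  show "0 \<in> periods"
    using add_subgroupD(1)[OF C_subgroup] by (simp add: periods_def)
  show "x + y \<in> periods" if "x \<in> periods" "y \<in> periods" for x y
    using that add_subgroupD(2)[OF C_subgroup] by (simp add: periods_def add.assoc[symmetric])
  show "- x \<in> periods" if "x \<in> periods" for x
  proof -
    have "w i (c + - x) = w i c" if "i \<in> I" for i c
    proof -
      have "w i ((c - x) + x) = w i (c - x)"
        using \<open>x \<in> periods\<close> that unfolding periods_def by blast
      then show ?thesis by simp
    qed
    then show ?thesis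
      using that add_subgroupD(3)[OF C_subgroup] by (simp add: periods_def)
  qed
qed

text \<open>Shifting a component that carries a non-empty slice by a period gives another such
  component, and there are only finitely many of them.\<close>

lemma finite_periods: "finite periods"
proof -
  obtain i c where ic: "i \<in> I" "w i c \<noteq> {}" using w_nonempty by blast
  have "(\<lambda>s. c + s) ` periods \<subseteq> support"
    using ic unfolding periods_def support_def by auto
  then have "finite ((\<lambda>s. c + s) ` periods)"
    using finite_support finite_subset unfolding support_def by blast
  then show ?thesis
    by (rule finite_imageD) (simp add: inj_on_def)
qed

text \<open>This yields injectivity of the internal projection once \<open>C\<close> is forgotten.
  The multiples of the lattice point have periods \<open>f m\<close> as
  \<open>C\<close>-coordinates. If two of these agree, the difference of the multiples has internal
  part 0 and vanishes by \<open>L_inj_int\<close>; so for \<open>a \<noteq> 0\<close> infinitely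
  many periods would arise.\<close>

lemma L_periods_inj:
  assumes "(a, 0, s) \<in> L" "s \<in> periods"
  shows "a = 0"
proof (rule ccontr)
  assume "a \<noteq> 0"
  then obtain i where i: "a i \<noteq> 0" by (auto simp: fun_eq_iff)
  have "\<exists>s'\<in>periods. ((\<lambda>i. real m * a i), 0, s') \<in> L" for m
  proof (induction m)
    case 0
    then show ?case
      using L_0 add_subgroupD(1)[OF periods_subgroup] by (auto simp: zero_fun_def)
  next
    case (Suc m)
    then obtain s' where s': "s' \<in> periods" "((\<lambda>i. real m * a i), 0, s') \<in> L" by blast
    have "(\<lambda>i. real m * a i) + a = (\<lambda>i. real (Suc m) * a i)"
      by (auto simp: fun_eq_iff algebra_simps)
    then have "((\<lambda>i. real (Suc m) * a i), 0, s' + s) \<in> L"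
      using L_add[OF s'(2) assms(1)] by simp
    then show ?case
      using add_subgroupD(2)[OF periods_subgroup s'(1) assms(2)] by blast
  qed
  then obtain f where f: "\<And>m. f m \<in> periods" "\<And>m. ((\<lambda>i. real m * a i), 0, f m) \<in> L" by metis
  have "inj f"
  proof (rule injI)
    fix m m' assume "f m = f m'"
    then have "((\<lambda>i. real m * a i) - (\<lambda>i. real m' * a i), 0, 0) \<in> L"
      using L_diff[OF f(2)[of m] f(2)[of m']] by simp
    then have "(\<lambda>i. real m * a i) - (\<lambda>i. real m' * a i) = 0" by (rule L_inj_int)
    then have "real m * a i = real m' * a i" by (metis eq_iff_diff_eq_0)
    with i show "m = m'" by simp
  qed
  moreover have "finite (range f)"
    using f(1) finite_periods by (meson finite_subset image_subsetI)
  ultimately show False using finite_imageD infinite_UNIV_nat by blast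
qed

text \<open>Lattice vectors test inclusion only at a dense set of positions, which suffices for
  regular closed slices: if the shift of \<open>u\<close> left the closed target slice, so would the
  shifts of all points near \<open>u\<close>. Some of these are interior to \<open>w j e\<close>,
  and a lattice vector carries \<open>b\<close> to one of them. Asking \<open>sub\<close> only for
  interior points makes its failure an open condition.\<close>

lemma shifted_window_subset:
  assumes bb: "b \<in> topspace (Euclidean_space n)" "b' \<in> topspace (Euclidean_space n)"
    and "c \<in> C" "j \<in> I" "e \<in> C" and u: "u \<in> w j e"
    and sub: "\<And>\<alpha> \<beta> \<kappa>. (\<alpha>, \<beta>, \<kappa>) \<in> L \<Longrightarrow> b + \<beta> \<in> Euclidean_space n interior_of w j (c + \<kappa>) \<Longrightarrow>
      b' + \<beta> \<in> w j (c' + \<kappa>)"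
  shows "u + (b' - b) \<in> w j (e + (c' - c))"
proof (rule ccontr)
  assume not: "u + (b' - b) \<notin> w j (e + (c' - c))"
  let ?E = "Euclidean_space n"
  note G = topological_group_on_Euclidean_space[of n]
  note E = add_subgroup_Euclidean_space[of n]
  define O' where "O' = {x \<in> topspace ?E. x + (b' - b) \<in> topspace ?E - w j (e + (c' - c))}"
  have t: "b' - b \<in> topspace ?E" by (rule add_subgroupD(4)[OF E bb(2,1)])
  have "openin ?E O'"
    unfolding O'_def
    using homeomorphic_imp_continuous_map[OF homeomorphic_map_translation[OF G t]] w_closed[OF \<open>j \<in> I\<close>]
    by (intro openin_continuous_map_preimage) auto
  moreover have uE: "u \<in> topspace ?E" using u w_subset \<open>j \<in> I\<close> by blast
  then have "u \<in> O'"
    using not add_subgroupD(2)[OF E uE t] by (simp add: O'_def)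
  moreover have "u \<in> ?E closure_of (?E interior_of w j e)"
    using u w_regular[OF \<open>j \<in> I\<close>] by metis
  ultimately obtain y where y: "y \<in> ?E interior_of w j e" "y \<in> O'"
    by (auto simp: in_closure_of)
  \<comment> \<open>A lattice vector with internal part in \<open>?P\<close> and component
    \<open>e - c\<close> carries \<open>b\<close>, seen over \<open>c\<close>, into the chosen open
    set over \<open>e\<close>.\<close>
  let ?P = "(\<lambda>x. x + - b) ` (?E interior_of w j e \<inter> O')"
  have "openin ?E ?P"
    using \<open>openin ?E O'\<close> add_subgroupD(3)[OF E bb(1)] by (intro openin_translation[OF G]) auto
  moreover have "?P \<noteq> {}" using y by blast
  moreover have "e - c \<in> C" using assms C_subgroup by (intro add_subgroupD(4)) auto
  ultimately obtain \<alpha> \<beta> where \<beta>: "(\<alpha>, \<beta>, e - c) \<in> L" "\<beta> \<in> ?P"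
    using L_dense by blast
  then have *: "b + \<beta> \<in> ?E interior_of w j e" "b + \<beta> \<in> O'" by auto
  then have "b' + \<beta> \<in> w j (c' + (e - c))"
    using sub[OF \<beta>(1)] by simp
  moreover have "b' + \<beta> = b + \<beta> + (b' - b)" "c' + (e - c) = e + (c' - c)" by simp_all
  ultimately show False
    using *(2) unfolding O'_def by auto
qed

text \<open>Both alternatives pair an interior with the complement of a closed set, so each persists
  for nearby \<open>b\<close> and \<open>b'\<close>; compactness will need this. If all of them
  fail, translation by \<open>(t, s)\<close> and its inverse both preserve the windows.\<close>

lemma windows_distinguished:
  assumes bb: "b \<in> topspace (Euclidean_space n)" "b' \<in> topspace (Euclidean_space n)"
    and cc: "c \<in> C" "c' \<in> C" and not: "c' - c \<notin> periods"
  shows "\<exists>\<alpha> \<beta> \<kappa>. (\<alpha>, \<beta>, \<kappa>) \<in> L \<and> (\<exists>j\<in>I.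
      (b + \<beta> \<in> Euclidean_space n interior_of w j (c + \<kappa>) \<and> b' + \<beta> \<notin> w j (c' + \<kappa>)) \<or>
      (b' + \<beta> \<in> Euclidean_space n interior_of w j (c' + \<kappa>) \<and> b + \<beta> \<notin> w j (c + \<kappa>)))"
proof (rule ccontr)
  assume neg: "\<not> ?thesis"
  define s t where "s = c' - c" and "t = b' - b"
  have s: "s \<in> C" unfolding s_def using cc C_subgroup by (intro add_subgroupD(4)) auto
  have fwd: "u + t \<in> w j (e + s)" if "j \<in> I" "e \<in> C" "u \<in> w j e" for j e u
    unfolding s_def t_def using neg that by (intro shifted_window_subset[OF bb cc(1)]) auto
  have bwd: "u - t \<in> w j (e - s)" if "j \<in> I" "e \<in> C" "u \<in> w j e" for j e u
  proof -
    have "u + (b - b') \<in> w j (e + (c - c'))"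
      using neg that by (intro shifted_window_subset[OF bb(2,1) cc(2)]) auto
    then show ?thesis by (simp add: s_def t_def algebra_simps)
  qed
  have "t = 0"
  proof
    fix i
    obtain j e u where j: "j \<in> I" "u \<in> w j e" using w_nonempty by blast
    then have e: "e \<in> C" using w_support by blast
    \<comment> \<open>Iterating \<open>fwd\<close> keeps the orbit \<open>u + m t\<close> within the
      \<open>j\<close>-th window. Its slices have a compact union, so each coordinate of the orbit
      is bounded.\<close>
    have "\<exists>e\<in>C. (\<lambda>i. u i + real m * t i) \<in> w j e" for m
    proof (induction m)
      case 0
      then show ?case using j e by auto
    next
      case (Suc m)
      then obtain e' where e': "e' \<in> C" "(\<lambda>i. u i + real m * t i) \<in> w j e'" by blast
      have "(\<lambda>i. u i + real m * t i) + t = (\<lambda>i. u i + real (Suc m) * t i)"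
        by (auto simp: fun_eq_iff algebra_simps)
      then have "(\<lambda>i. u i + real (Suc m) * t i) \<in> w j (e' + s)"
        using fwd[OF j(1) e'] by simp
      then show ?case using add_subgroupD(2)[OF C_subgroup e'(1) s] by blast
    qed
    moreover have "compactin (Euclidean_space n) (\<Union>((\<lambda>e. w j e) ` support))"
      using w_compact[OF j(1)] finite_support unfolding support_def
      by (intro compactin_Union) auto
    then obtain M where "\<And>x. x \<in> (\<Union>((\<lambda>e. w j e) ` support)) \<Longrightarrow> \<bar>x i\<bar> \<le> M"
      using compactin_Euclidean_bounded by blast
    ultimately have M: "\<bar>u i + real m * t i\<bar> \<le> M" for m
      using j(1) unfolding support_def by fast
    show "t i = 0 i"
    proof (rule ccontr)
      assume "t i \<noteq> 0 i"
      then have "\<bar>t i\<bar> > 0" by simp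
      \<comment> \<open>The bounds at \<open>m\<close> and at 0 together limit the displacement to
        \<open>2 * M\<close>.\<close>
      then obtain m where "real m * \<bar>t i\<bar> > 2 * M" using reals_Archimedean3 by blast
      then have "\<bar>real m * t i\<bar> > 2 * M" by (simp add: abs_mult)
      with M[of m] M[of 0] show False by (simp; linarith)
    qed
  qed
  have "w j (e + s) = w j e" if "j \<in> I" for j e
  proof (cases "e \<in> C")
    case True
    then have "e + s \<in> C" using add_subgroupD(2)[OF C_subgroup] s by blast
    then show ?thesis
      using fwd[OF that True] bwd[OF that \<open>e + s \<in> C\<close>] \<open>t = 0\<close> by auto
  next
    case False
    then have "e + s \<notin> C" using add_subgroupD(4)[OF C_subgroup _ s, of "e + s"] by auto
    then show ?thesis using False w_support[OF that] by blast
  qed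
  then have "s \<in> periods" using s by (simp add: periods_def)
  with not show False by (simp add: s_def)
qed

text \<open>Plain membership replaces interiors here because this is what a point set shows: whether
  the point displaced by the physical part of the lattice vector is present with colour
  \<open>j\<close>.\<close>

definition separates :: "((nat \<Rightarrow> real) \<times> (nat \<Rightarrow> real) \<times> 'k) set \<Rightarrow>
    (nat \<Rightarrow> real) \<Rightarrow> 'k \<Rightarrow> (nat \<Rightarrow> real) \<Rightarrow> 'k \<Rightarrow> bool" where
  "separates F b c b' c' \<longleftrightarrow>
     (\<exists>(\<alpha>, \<beta>, \<kappa>)\<in>F. \<exists>j\<in>I. b + \<beta> \<in> w j (c + \<kappa>) \<longleftrightarrow> b' + \<beta> \<notin> w j (c' + \<kappa>))"

lemma separates_mono: "separates F b c b' c' \<Longrightarrow> F \<subseteq> F' \<Longrightarrow> separates F' b c b' c'"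
  unfolding separates_def by blast

lemma compact_pieces_separated:
  assumes i: "i \<in> I" "i' \<in> I" and cc: "c \<in> C" "c' \<in> C" and not: "c' - c \<notin> periods"
  shows "\<exists>F. finite F \<and> F \<subseteq> L \<and> (\<forall>b\<in>w i c. \<forall>b'\<in>w i' c'. separates F b c b' c')"
proof -
  let ?E = "Euclidean_space n" and ?E2 = "prod_topology (Euclidean_space n) (Euclidean_space n)"
  \<comment> \<open>\<open>A\<close> and \<open>B\<close> are the two open conditions of
    \<open>windows_distinguished\<close>; \<open>G \<delta>\<close> is the open set of pairs that
    the lattice vector \<delta> tells apart. These sets cover the compact product of the two
    slices.\<close>
  define A B where "A = (\<lambda>c \<beta> \<kappa> j. {x \<in> topspace ?E. x + \<beta> \<in> ?E interior_of w j (c + \<kappa>)})"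
    and "B = (\<lambda>c \<beta> \<kappa> j. {x \<in> topspace ?E. x + \<beta> \<in> topspace ?E - w j (c + \<kappa>)})"
  define G where "G = (\<lambda>(\<alpha>::nat \<Rightarrow> real, \<beta>, \<kappa>). \<Union>j\<in>I. A c \<beta> \<kappa> j \<times> B c' \<beta> \<kappa> j \<union> B c \<beta> \<kappa> j \<times> A c' \<beta> \<kappa> j)"
  have tr: "continuous_map ?E ?E (\<lambda>x. x + \<beta>)" if "\<beta> \<in> topspace ?E" for \<beta>
    using homeomorphic_imp_continuous_map[OF homeomorphic_map_translation[OF topological_group_on_Euclidean_space that]] .
  have AB: "openin ?E (A c \<beta> \<kappa> j)" "openin ?E (B c \<beta> \<kappa> j)" if "\<beta> \<in> topspace ?E" "j \<in> I" for c \<beta> \<kappa> j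
    unfolding A_def B_def
    by (rule openin_continuous_map_preimage[OF tr[OF that(1)] openin_interior_of]
        openin_continuous_map_preimage[OF tr[OF that(1)]
          openin_diff[OF openin_topspace w_closed[OF that(2)]]])+
  have "openin ?E2 V" if "V \<in> G ` L" for V
  proof -
    from that obtain \<delta> where "\<delta> \<in> L" "V = G \<delta>" by blast
    then obtain \<alpha> \<beta> \<kappa> where V: "(\<alpha>, \<beta>, \<kappa>) \<in> L" "V = G (\<alpha>, \<beta>, \<kappa>)"
      by (cases \<delta>) simp
    show ?thesis
      unfolding V(2) G_def using AB[OF L_D(2)[OF V(1)]]
      by (auto intro!: openin_Union simp: openin_prod_Times_iff)
  qed
  moreover have "compactin ?E2 (w i c \<times> w i' c')"
    using w_compact i by (simp add: compactin_Times)
  moreover have "w i c \<times> w i' c' \<subseteq> \<Union>(G ` L)"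
  proof clarify
    fix b b' assume b: "b \<in> w i c" "b' \<in> w i' c'"
    then have bE: "b \<in> topspace ?E" "b' \<in> topspace ?E" using w_subset i by blast+
    obtain \<alpha> \<beta> \<kappa> j where *: "(\<alpha>, \<beta>, \<kappa>) \<in> L" "j \<in> I"
      "(b + \<beta> \<in> ?E interior_of w j (c + \<kappa>) \<and> b' + \<beta> \<notin> w j (c' + \<kappa>)) \<or>
       (b' + \<beta> \<in> ?E interior_of w j (c' + \<kappa>) \<and> b + \<beta> \<notin> w j (c + \<kappa>))"
      using windows_distinguished[OF bE cc not] by blast
    have "b + \<beta> \<in> topspace ?E" "b' + \<beta> \<in> topspace ?E"
      using bE L_D(2)[OF *(1)] add_subgroupD(2)[OF add_subgroup_Euclidean_space] by blast+
    with * bE have "(b, b') \<in> G (\<alpha>, \<beta>, \<kappa>)"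
      unfolding G_def A_def B_def by auto
    with *(1) show "(b, b') \<in> \<Union>(G ` L)" by blast
  qed
  ultimately have "\<exists>\<F>. finite \<F> \<and> \<F> \<subseteq> G ` L \<and> w i c \<times> w i' c' \<subseteq> \<Union>\<F>"
    by (rule_tac compactinD)
  then obtain F where F: "finite F" "F \<subseteq> L" "w i c \<times> w i' c' \<subseteq> \<Union>(G ` F)"
    by (metis finite_subset_image)
  have "separates F b c b' c'" if b: "b \<in> w i c" "b' \<in> w i' c'" for b b'
  proof -
    obtain \<alpha> \<beta> \<kappa> where *: "(\<alpha>, \<beta>, \<kappa>) \<in> F" "(b, b') \<in> G (\<alpha>, \<beta>, \<kappa>)"
      using F(3) b by fast
    then obtain j where j: "j \<in> I"
        "(b, b') \<in> A c \<beta> \<kappa> j \<times> B c' \<beta> \<kappa> j \<union> B c \<beta> \<kappa> j \<times> A c' \<beta> \<kappa> j"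
      unfolding G_def by auto
    then have "b + \<beta> \<in> w j (c + \<kappa>) \<longleftrightarrow> b' + \<beta> \<notin> w j (c' + \<kappa>)"
      using interior_of_subset[of ?E "w j (c + \<kappa>)"] interior_of_subset[of ?E "w j (c' + \<kappa>)"]
      unfolding A_def B_def by auto
    with *(1) j(1) show ?thesis unfolding separates_def by blast
  qed
  with F show ?thesis by blast
qed

text \<open>Only finitely many pairs of slices are non-empty, so the finite sets found for the
  single pairs can be united. One finite \<open>F\<close> for all pairs is what gives a finite
  radius later.\<close>

lemma windows_uniformly_separated:
  "\<exists>F. finite F \<and> F \<subseteq> L \<and> (\<forall>i\<in>I. \<forall>i'\<in>I. \<forall>c c'. \<forall>b\<in>w i c. \<forall>b'\<in>w i' c'.
     c' - c \<notin> periods \<longrightarrow> separates F b c b' c')"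
proof -
  let ?P = "\<lambda>(i, i', c, c') F. c' - c \<notin> periods \<longrightarrow> (\<forall>b\<in>w i c. \<forall>b'\<in>w i' c'. separates F b c b' c')"
  have "\<exists>F. finite F \<and> F \<subseteq> L \<and> (\<forall>x\<in>I \<times> I \<times> support \<times> support. ?P x F)"
  proof (rule finite_union_of_witnesses)
    show "finite (I \<times> I \<times> support \<times> support)"
      using finite_I finite_support by (simp add: support_def)
    show "\<exists>F. finite F \<and> F \<subseteq> L \<and> ?P x F" if x: "x \<in> I \<times> I \<times> support \<times> support" for x
    proof -
      obtain i i' c c' where [simp]: "x = (i, i', c, c')" by (cases x)
      have "c \<in> C" "c' \<in> C" using x w_support by (auto simp: support_def)
      then show ?thesis
        using compact_pieces_separated[of i i' c c'] x by (cases "c' - c \<in> periods") auto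
    qed
    show "?P x F'" if "?P x F" "F \<subseteq> F'" for x F F'
      using that by (auto intro: separates_mono)
  qed
  then obtain F where F: "finite F" "F \<subseteq> L" "\<forall>x\<in>I \<times> I \<times> support \<times> support. ?P x F"
    by (elim exE conjE)
  have "separates F b c b' c'"
    if "i \<in> I" "i' \<in> I" "b \<in> w i c" "b' \<in> w i' c'" "c' - c \<notin> periods" for i i' c c' b b'
  proof -
    have "(i, i', c, c') \<in> I \<times> I \<times> support \<times> support"
      using that unfolding support_def by blast
    from bspec[OF F(3) this] that show ?thesis by simp
  qed
  with F(1,2) show ?thesis
    by (intro exI[of _ F] conjI ballI allI impI)
qed

end

subsection \<open>The scheme with Euclidean internal space\<close>

text \<open>Finitely many test vectors replace the ball. One implication is enough because the
  hypotheses are symmetric in \<open>x\<close> and \<open>y\<close>.\<close>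

lemma locally_derivableI:
  fixes A :: "((nat \<Rightarrow> real) \<times> 'b) set" and B :: "((nat \<Rightarrow> real) \<times> 'c) set"
  assumes P: "finite P" "P \<subseteq> topspace (Euclidean_space d)"
    and local: "\<And>x y c. x \<in> topspace (Euclidean_space d) \<Longrightarrow> y \<in> topspace (Euclidean_space d) \<Longrightarrow>
      (\<And>p e. p \<in> P \<Longrightarrow> (x + p, e) \<in> A \<longleftrightarrow> (y + p, e) \<in> A) \<Longrightarrow> (x, c) \<in> B \<Longrightarrow> (y, c) \<in> B"
  shows "locally_derivable_from d B A"
proof -
  \<comment> \<open>The 1 keeps the radius positive and the maximum defined when \<open>P\<close> is
    empty.\<close>
  define R where "R = Max (insert 1 ((\<lambda>p. L2_set p {..<d}) ` P))"
  have R: "R \<ge> 1" "\<And>p. p \<in> P \<Longrightarrow> L2_set p {..<d} \<le> R"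
    using P(1) by (auto simp: R_def)
  have tr: "(q, c) \<in> translate_by X x \<longleftrightarrow> (x + q, c) \<in> X" for q c x and X :: "((nat \<Rightarrow> real) \<times> 'e) set"
    unfolding translate_by_def by (force simp: algebra_simps image_iff)
  have "restrict_to (translate_by B x) {0} = restrict_to (translate_by B y) {0}"
    if xy: "x \<in> topspace (Euclidean_space d)" "y \<in> topspace (Euclidean_space d)"
      and eq: "restrict_to (translate_by A x) (ball0 d R) = restrict_to (translate_by A y) (ball0 d R)" for x y
  proof -
    have *: "(x + p, e) \<in> A \<longleftrightarrow> (y + p, e) \<in> A" if "p \<in> P" for p e
    proof -
      have "p \<in> ball0 d R" using that P(2) R(2) by (auto simp: ball0_def)
      then have "(p, e) \<in> restrict_to (translate_by A z) (ball0 d R) \<longleftrightarrow> (z + p, e) \<in> A" for z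
        by (simp add: restrict_to_def tr)
      then show ?thesis using eq by blast
    qed
    have "(x, c) \<in> B \<longleftrightarrow> (y, c) \<in> B" for c
      using local[OF xy, of c] local[OF xy(2,1), of c] * by blast
    then show ?thesis
      unfolding restrict_to_def by (auto simp: tr)
  qed
  moreover have "R > 0" using R(1) by simp
  ultimately show ?thesis
    unfolding locally_derivable_from_def by (intro exI[of _ R] conjI ballI impI)
qed

text \<open>\<open>(\<alpha> c, \<beta> c, c)\<close> is the lattice point chosen over
  \<open>c\<close>. The map \<open>enc\<close> turns sets of slices into numbers, so that the type
  of the new colours does not depend on the original scheme.\<close>

locale overlay_scheme = sliced_scheme d n C L I w
  for d n :: nat and C :: "'k::ab_group_add set"
    and L :: "((nat \<Rightarrow> real) \<times> (nat \<Rightarrow> real) \<times> 'k) set"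
    and I :: "'c set" and w :: "'c \<Rightarrow> 'k \<Rightarrow> (nat \<Rightarrow> real) set" +
  fixes \<alpha> \<beta> :: "'k \<Rightarrow> nat \<Rightarrow> real" and enc :: "('c \<times> 'k) set \<Rightarrow> nat"
  assumes representatives: "c \<in> support \<Longrightarrow> (\<alpha> c, \<beta> c, c) \<in> L"
    and enc_inj: "inj_on enc (Pow (I \<times> support))"
begin

abbreviation "ES \<equiv> prod_topology (Euclidean_space d) (Euclidean_space n)"

definition reduced :: "((nat \<Rightarrow> real) \<times> (nat \<Rightarrow> real)) set" where
  "reduced = {(a, b). \<exists>s\<in>periods. (a, b, s) \<in> L}"

definition U :: "'c \<times> 'k \<Rightarrow> (nat \<Rightarrow> real) set" where
  "U = (\<lambda>(i, c). {b \<in> topspace (Euclidean_space n). b + \<beta> c \<in> w i c})"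

abbreviation "J \<equiv> I \<times> support"

text \<open>For \<open>(a, b)\<close> in the new lattice this set, encoded, is the colour of
  \<open>a\<close>; the empty set stands for the absence of a point.\<close>

definition visible :: "(nat \<Rightarrow> real) \<Rightarrow> ('c \<times> 'k) set" where
  "visible b = {j \<in> J. b \<in> U j}"

abbreviation "cell \<equiv> overlay_cell (Euclidean_space n) U J"

text \<open>The colours are encodings of sets \<open>A\<close> of translated slices; \<^term>\<open>cell A\<close> is the closure of the
  points which lie in exactly the slices from \<open>A\<close>.\<close>

definition flat :: "(nat \<Rightarrow> real, nat) cut_project" where
  "flat = \<lparr>total = Euclidean_space (d + n), phys = topspace (Euclidean_space d),
     intern = join d 0 ` topspace (Euclidean_space n),
     lattice = (\<lambda>(a, b). join d a b) ` reduced, coord = id, colours = enc ` (Pow J - {{}}),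
     window = (\<lambda>k. join d 0 ` cell (the_inv_into (Pow J) enc k))\<rparr>"

section \<open>The new lattice\<close>

lemma finite_J: "finite J"
  using finite_I finite_support by (simp add: support_def)

lemma group_ES: "topological_group_on ES"
  by (intro topological_group_on_prod topological_group_on_Euclidean_space)

lemma reduced_D:
  assumes "(a, b) \<in> reduced"
  shows "a \<in> topspace (Euclidean_space d)" "b \<in> topspace (Euclidean_space n)"
  using assms L_D by (auto simp: reduced_def)

lemma reduced_inj:
  shows "(0, b) \<in> reduced \<Longrightarrow> b = 0" and "(a, 0) \<in> reduced \<Longrightarrow> a = 0"
  using L_inj_phys L_periods_inj by (auto simp: reduced_def)

lemma reduced_subgroup: "add_subgroup reduced"
  unfolding add_subgroup_def
proof (intro conjI ballI)
  show "0 \<in> reduced"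
    using L_0 add_subgroupD(1)[OF periods_subgroup] by (auto simp: reduced_def zero_prod_def)
  show "x + y \<in> reduced" if "x \<in> reduced" "y \<in> reduced" for x y
    using that L_add add_subgroupD(2)[OF periods_subgroup] by (fastforce simp: reduced_def)
  show "- x \<in> reduced" if "x \<in> reduced" for x
    using that L_diff[OF L_0] add_subgroupD(3)[OF periods_subgroup] by (fastforce simp: reduced_def)
qed

lemma reduced_dense:
  assumes "openin (Euclidean_space n) O'" "O' \<noteq> {}"
  shows "\<exists>a b. (a, b) \<in> reduced \<and> b \<in> O'"
  using L_dense[OF add_subgroupD(1)[OF C_subgroup] assms] add_subgroupD(1)[OF periods_subgroup]
  by (auto simp: reduced_def)

lemma zero_in_ES: "0 \<in> topspace ES"
  using group_ES add_subgroupD(1) unfolding topological_group_on_def by blast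

text \<open>
  Over each of the finitely many periods \<open>s\<close>, a small neighbourhood of \<open>0\<close> contains at most one point
  of the lattice, which can then be removed from it.
\<close>

lemma reduced_discrete: "\<exists>O'. openin ES O' \<and> 0 \<in> O' \<and> O' \<inter> reduced \<subseteq> {0}"
proof -
  obtain O0 where O0: "openin ES O0" "(0, 0) \<in> O0" "\<And>a b. (a, b, 0) \<in> L \<Longrightarrow> (a, b) \<in> O0 \<Longrightarrow> a = 0 \<and> b = 0"
    using L_discrete by blast
  let ?N = "{p \<in> topspace (prod_topology ES ES). (case p of (x, y) \<Rightarrow> x - y) \<in> O0}"
  define N where "N = ?N"
  have "openin (prod_topology ES ES) N" unfolding N_def
    using group_ES O0(1) unfolding topological_group_on_def
    by (intro openin_continuous_map_preimage) auto
  moreover have "(0, 0) \<in> N" unfolding N_def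
    using zero_in_ES O0(2) by (simp add: zero_prod_def)
  ultimately have "\<exists>V1 V2. openin ES V1 \<and> openin ES V2 \<and> 0 \<in> V1 \<and> 0 \<in> V2 \<and> V1 \<times> V2 \<subseteq> N"
    by (rule iffD1[OF openin_prod_topology_alt, rule_format])
  then obtain V1 V2 where V: "openin ES V1" "openin ES V2" "0 \<in> V1" "0 \<in> V2" "V1 \<times> V2 \<subseteq> N"
    by (elim exE conjE)
  \<comment> \<open>Differences of points of \<open>V\<close> fall into \<open>O0\<close>, so two
    lattice points in \<open>V\<close> over the same \<open>s\<close> coincide: their difference
    lies over 0.\<close>
  define V where "V = V1 \<inter> V2"
  have openV: "openin ES V" "0 \<in> V" and V_diff: "\<And>p q. p \<in> V \<Longrightarrow> q \<in> V \<Longrightarrow> p - q \<in> O0"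
    using V unfolding V_def N_def by auto
  have "\<exists>O'. openin ES O' \<and> 0 \<in> O' \<and> (\<forall>a b. (a, b) \<in> O' \<and> (a, b, s) \<in> L \<longrightarrow> (a, b) = 0)" for s
  proof (cases "\<exists>a b. (a, b) \<in> V \<and> (a, b, s) \<in> L \<and> (a, b) \<noteq> 0")
    case True
    then obtain a b where ab: "(a, b) \<in> V" "(a, b, s) \<in> L" "(a, b) \<noteq> 0" by blast
    have "closedin ES {(a, b)}"
      using ab(1) openin_subset[OF openV(1)] Hausdorff_Euclidean_space
      by (intro closedin_Hausdorff_singleton) (auto simp: Hausdorff_space_prod_topology)
    moreover have "(a', b') = (a, b)" if "(a', b') \<in> V" "(a', b', s) \<in> L" for a' b'
      using O0(3)[of "a - a'" "b - b'"] L_diff[OF ab(2) that(2)] V_diff[OF ab(1) that(1)] by auto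
    ultimately show ?thesis
      using openV ab(3) by (intro exI[of _ "V - {(a, b)}"]) auto
  qed (use openV in blast)
  then obtain f where f: "\<And>s. openin ES (f s)" "\<And>s. 0 \<in> f s"
    "\<And>s a b. (a, b) \<in> f s \<Longrightarrow> (a, b, s) \<in> L \<Longrightarrow> (a, b) = 0" by metis
  have "openin ES (topspace ES \<inter> \<Inter>(f ` periods))"
    using f(1) finite_periods by (intro openin_Int_Inter openin_topspace) auto
  moreover have "0 \<in> topspace ES \<inter> \<Inter>(f ` periods)"
    using f(2) zero_in_ES by blast
  moreover have "(topspace ES \<inter> \<Inter>(f ` periods)) \<inter> reduced \<subseteq> {0}"
    using f(3) unfolding reduced_def by auto
  ultimately show ?thesis by blast
qed

text \<open>The approximating lattice points can be taken over the finitely many components in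
  \<open>F\<close>. Subtracting a fixed lattice point \<open>p c\<close> over the same component
  moves them over 0, and the error is absorbed by translating \<open>K\<close>.\<close>

lemma reduced_cocompact:
  "\<exists>K. compactin ES K \<and> (\<forall>x\<in>topspace ES. \<exists>\<gamma>\<in>reduced. x - \<gamma> \<in> K)"
proof -
  obtain K F where K: "compactin ES K" "finite F"
    and cover: "\<And>a b. a \<in> topspace (Euclidean_space d) \<Longrightarrow> b \<in> topspace (Euclidean_space n) \<Longrightarrow>
      \<exists>a' b' c'. (a', b', c') \<in> L \<and> (a - a', b - b') \<in> K \<and> c' \<in> F"
    using L_cocompact by metis
  have "\<exists>a b. (a, b, c) \<in> L" if "c \<in> C" for c
    using L_dense[OF that openin_topspace] add_subgroupD(1)[OF add_subgroup_Euclidean_space[of n]] by blast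
  then obtain a0 b0 where "\<And>c. c \<in> C \<Longrightarrow> (a0 c, b0 c, c) \<in> L" by metis
  then obtain p where p: "\<And>c. c \<in> C \<Longrightarrow> (fst (p c), snd (p c), c) \<in> L"
    using that[of "\<lambda>c. (a0 c, b0 c)"] by auto
  let ?K = "\<Union>c\<in>F \<inter> C. (\<lambda>x. x + p c) ` K"
  have "p c \<in> topspace ES" if "c \<in> C" for c
    using L_D[OF p[OF that]] by (simp add: mem_Times_iff)
  then have "compactin ES ((\<lambda>x. x + p c) ` K)" if "c \<in> C" for c
    using that compactin_translation[OF group_ES _ K(1)] by blast
  then have "compactin ES ?K"
    using K(2) by (intro compactin_Union) auto
  moreover have "\<exists>\<gamma>\<in>reduced. x - \<gamma> \<in> ?K" if xE: "x \<in> topspace ES" for x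
  proof -
    obtain a b where x: "x = (a, b)" "a \<in> topspace (Euclidean_space d)" "b \<in> topspace (Euclidean_space n)"
      using xE by (cases x) auto
    obtain a' b' c where c: "(a', b', c) \<in> L" "(a - a', b - b') \<in> K" "c \<in> F"
      using cover[OF x(2,3)] by blast
    then have "c \<in> C" using L_D by blast
    have "(a' - fst (p c), b' - snd (p c)) \<in> reduced"
      using L_diff[OF c(1) p[OF \<open>c \<in> C\<close>]] add_subgroupD(1)[OF periods_subgroup]
      by (auto simp: reduced_def)
    moreover have "x - (a' - fst (p c), b' - snd (p c)) = (a - a', b - b') + p c"
      by (simp add: x prod_eq_iff)
    ultimately show ?thesis
      using c \<open>c \<in> C\<close> by (intro bexI[of _ "(a' - fst (p c), b' - snd (p c))"]) auto
  qed
  ultimately show ?thesis by blast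
qed

lemma homeomorphic_map_join: "homeomorphic_map ES (Euclidean_space (d + n)) (\<lambda>(a, b). join d a b)"
  using homeomorphic_maps_join homeomorphic_maps_imp_map by blast

lemma flat_lattice: "discrete_cocompact_subgroup (Euclidean_space (d + n)) ((\<lambda>(a, b). join d a b) ` reduced)"
proof -
  let ?h = "\<lambda>(a, b). join d a b" and ?E = "Euclidean_space (d + n)"
  have sub: "?h ` reduced \<subseteq> topspace ?E"
    using reduced_D join_in by auto
  have h_diff: "?h (x - y) = ?h x - ?h y" for x y by (cases x; cases y) (simp add: join_diff)
  have h_add: "?h (x + y) = ?h x + ?h y" for x y by (cases x; cases y) (simp add: join_add)
  have h_0: "?h 0 = 0" by (simp add: zero_prod_def join_0)
  have grp: "add_subgroup (?h ` reduced)"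
    by (rule add_subgroup_image[OF reduced_subgroup h_add])
  obtain O' where O': "openin ES O'" "0 \<in> O'" "O' \<inter> reduced \<subseteq> {0}"
    using reduced_discrete by blast
  have "openin ?E (?h ` O')"
    using homeomorphic_map_openness[OF homeomorphic_map_join] O'(1) openin_subset by blast
  moreover have "0 \<in> ?h ` O'"
    using imageI[OF O'(2), of ?h] unfolding h_0 .
  moreover have "?h ` O' \<inter> ?h ` reduced \<subseteq> {0}"
  proof clarify
    fix a b a' b' assume *: "(a, b) \<in> O'" "(a', b') \<in> reduced" "join d a b = join d a' b'"
    then have "a \<in> topspace (Euclidean_space d)" using openin_subset[OF O'(1)] by auto
    with * reduced_D[OF *(2)] have "(a, b) = (a', b')" by (simp add: join_inject)
    then have "(a, b) = 0" using * O'(3) by auto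
    then show "join d a b = 0" by (simp add: zero_prod_def join_0)
  qed
  ultimately have disc: "subtopology ?E (?h ` reduced) = discrete_topology (?h ` reduced)"
    by (subst discrete_subgroup_iff[OF topological_group_on_Euclidean_space grp sub]) blast
  obtain K where K: "compactin ES K" "\<And>x. x \<in> topspace ES \<Longrightarrow> \<exists>\<gamma>\<in>reduced. x - \<gamma> \<in> K"
    using reduced_cocompact by blast
  have "compactin ?E (?h ` K)"
    using image_compactin[OF K(1) homeomorphic_imp_continuous_map[OF homeomorphic_map_join]] .
  moreover have "\<exists>\<gamma>\<in>?h ` reduced. x - \<gamma> \<in> ?h ` K" if xE: "x \<in> topspace ?E" for x
  proof -
    obtain a b where "a \<in> topspace (Euclidean_space d)" "b \<in> topspace (Euclidean_space n)" "x = join d a b"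
      using join_surj[OF xE] .
    then obtain y where y: "y \<in> topspace ES" "x = ?h y"
      using that[of "(a, b)"] by auto
    then obtain \<gamma> where "\<gamma> \<in> reduced" "y - \<gamma> \<in> K" using K(2) by blast
    then show ?thesis
      using y(2) h_diff[of y \<gamma>] by (intro bexI[of _ "?h \<gamma>"]) (metis imageI)+
  qed
  ultimately show ?thesis
    unfolding discrete_cocompact_subgroup_def using sub grp disc cocompactI[OF grp] by blast
qed

section \<open>Translated slices and cells at lattice points\<close>

lemma mem_U: "(i, c) \<in> J \<Longrightarrow> b \<in> topspace (Euclidean_space n) \<Longrightarrow> b \<in> U (i, c) \<longleftrightarrow> b + \<beta> c \<in> w i c"
  by (simp add: U_def)

lemma U_eq_image:
  assumes "(i, c) \<in> J"
  shows "U (i, c) = (\<lambda>x. x + - \<beta> c) ` w i c"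
proof -
  have E: "add_subgroup (topspace (Euclidean_space n))" by (rule add_subgroup_Euclidean_space)
  have \<beta>: "\<beta> c \<in> topspace (Euclidean_space n)" using representatives[of c] L_D(2) assms by blast
  have "w i c \<subseteq> topspace (Euclidean_space n)" using w_subset assms by blast
  then show ?thesis
    using add_subgroupD(4)[OF E _ \<beta>] unfolding U_def by (force simp: image_iff)
qed

lemma
  assumes "j \<in> J"
  shows U_compact: "compactin (Euclidean_space n) (U j)"
    and U_closed: "closedin (Euclidean_space n) (U j)"
    and U_frontier: "b \<in> topspace (Euclidean_space n) \<Longrightarrow> b \<in> Euclidean_space n frontier_of U j \<longleftrightarrow>
      b + \<beta> (snd j) \<in> Euclidean_space n frontier_of w (fst j) (snd j)"
    and U_interior: "b \<in> topspace (Euclidean_space n) \<Longrightarrow> b \<in> Euclidean_space n interior_of U j \<longleftrightarrow>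
      b + \<beta> (snd j) \<in> Euclidean_space n interior_of w (fst j) (snd j)"
proof -
  obtain i c where j: "j = (i, c)" "i \<in> I" "c \<in> support" using assms by auto
  note G = topological_group_on_Euclidean_space[of n]
  have "- \<beta> c \<in> topspace (Euclidean_space n)"
    using representatives[OF j(3)] L_D(2) add_subgroupD(3)[OF add_subgroup_Euclidean_space] by blast
  note hom = homeomorphic_map_translation[OF G this]
  have U: "U j = (\<lambda>x. x + - \<beta> c) ` w i c" using U_eq_image[of i c] j by simp
  show "compactin (Euclidean_space n) (U j)"
    unfolding U by (rule image_compactin[OF w_compact[OF j(2)] homeomorphic_imp_continuous_map[OF hom]])
  then show "closedin (Euclidean_space n) (U j)"
    by (intro compactin_imp_closedin Hausdorff_Euclidean_space)
  have "b \<in> (\<lambda>x. x + - \<beta> c) ` S \<longleftrightarrow> b + \<beta> c \<in> S" for b S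
    by (force simp: image_iff)
  then show "b \<in> Euclidean_space n frontier_of U j \<longleftrightarrow>
      b + \<beta> (snd j) \<in> Euclidean_space n frontier_of w (fst j) (snd j)"
    "b \<in> Euclidean_space n interior_of U j \<longleftrightarrow>
      b + \<beta> (snd j) \<in> Euclidean_space n interior_of w (fst j) (snd j)"
    using homeomorphic_map_frontier_of[OF hom w_subset[OF j(2)]]
      homeomorphic_map_interior_of[OF hom w_subset[OF j(2)]] j(1) unfolding U by auto
qed

lemma w_period: "i \<in> I \<Longrightarrow> s \<in> periods \<Longrightarrow> w i (s + c) = w i c"
  unfolding periods_def by (subst add.commute) blast

text \<open>Adding the representative over \<open>c\<close> gives an old lattice point over
  \<open>s + c\<close>, where the slice is the one over \<open>c\<close> since \<open>s\<close> is a
  period. Non-singularity of the old scheme then applies.\<close>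

lemma U_nonsingular:
  assumes "(a, b) \<in> reduced" "j \<in> J"
  shows "b \<notin> Euclidean_space n frontier_of U j"
proof -
  obtain i c where j: "j = (i, c)" "i \<in> I" "c \<in> support" using assms by auto
  obtain s where s: "(a, b, s) \<in> L" "s \<in> periods" using assms by (auto simp: reduced_def)
  then have "(a + \<alpha> c, b + \<beta> c, s + c) \<in> L" using L_add representatives[OF j(3)] by blast
  then have "b + \<beta> c \<notin> Euclidean_space n frontier_of w i (s + c)" using w_nonsingular j(2) by blast
  then show ?thesis
    using U_frontier[OF assms(2) reduced_D(2)[OF assms(1)]] j(1) w_period[OF j(2) s(2)] by simp
qed

lemma
  assumes "(a, b) \<in> reduced" "A \<subseteq> J"
  shows in_cell_iff: "b \<in> cell A \<longleftrightarrow> A = visible b"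
    and cell_nonsingular: "b \<notin> Euclidean_space n frontier_of cell A"
  using generic_in_overlay_cell_iff[OF finite_J U_closed reduced_D(2)[OF assms(1)]
      U_nonsingular[OF assms(1)] assms(2)]
    generic_not_in_frontier[OF finite_J U_closed reduced_D(2)[OF assms(1)]
      U_nonsingular[OF assms(1)] assms(2)]
  by (simp_all add: visible_def)

text \<open>Shows that the new window is not empty: a non-empty regular slice has interior points,
  and by density its translate has one coming from the new lattice.\<close>

lemma exists_visible: "\<exists>a b. (a, b) \<in> reduced \<and> visible b \<noteq> {}"
proof -
  obtain i c where ic: "i \<in> I" "w i c \<noteq> {}" using w_nonempty by blast
  then have J: "(i, c) \<in> J" by (auto simp: support_def)
  have "Euclidean_space n interior_of w i c \<noteq> {}"
    using ic w_regular[of i c] by auto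
  then obtain x where x: "x \<in> Euclidean_space n interior_of w i c" by blast
  have "x - \<beta> c \<in> topspace (Euclidean_space n)"
    using x interior_of_subset_topspace[of "Euclidean_space n"] representatives[of c] L_D(2) J
    by (intro add_subgroupD(4)[OF add_subgroup_Euclidean_space]) auto
  then have "x - \<beta> c \<in> Euclidean_space n interior_of U (i, c)"
    using U_interior[OF J] x by simp
  then obtain a b where "(a, b) \<in> reduced" "b \<in> Euclidean_space n interior_of U (i, c)"
    using reduced_dense[OF openin_interior_of] by blast
  then have "(i, c) \<in> visible b"
    using interior_of_subset[of "Euclidean_space n" "U (i, c)"] J unfolding visible_def by blast
  with \<open>(a, b) \<in> reduced\<close> show ?thesis by blast
qed

lemma enc_inverse: "A \<subseteq> J \<Longrightarrow> the_inv_into (Pow J) enc (enc A) = A"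
  using the_inv_into_f_f[OF enc_inj] by simp

section \<open>Projections and point set of the new scheme\<close>

lemma flat_proj_phys:
  assumes "a \<in> topspace (Euclidean_space d)" "b \<in> topspace (Euclidean_space n)"
  shows "proj_phys flat (join d a b) = a"
  unfolding proj_phys_def
proof (rule the_equality)
  show "a \<in> phys flat \<and> (\<exists>w\<in>intern flat. join d a b = a + w)"
    using assms join_split[OF assms(1)] by (auto simp: flat_def)
  show "v = a" if v0: "v \<in> phys flat \<and> (\<exists>w\<in>intern flat. join d a b = v + w)" for v
  proof -
    obtain b' where v: "v \<in> topspace (Euclidean_space d)" "join d a b = v + join d 0 b'"
      using v0 by (auto simp: flat_def)
    then have "join d a b = join d v b'" by (simp add: join_split)
    then show ?thesis using join_inject[OF assms(1) v(1)] by blast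
  qed
qed

lemma flat_proj_int:
  assumes "a \<in> topspace (Euclidean_space d)" "b \<in> topspace (Euclidean_space n)"
  shows "proj_int flat (join d a b) = join d 0 b"
  unfolding proj_int_def
proof (rule the_equality)
  show "join d 0 b \<in> intern flat \<and> (\<exists>v\<in>phys flat. join d a b = v + join d 0 b)"
    using assms join_split[OF assms(1)] by (auto simp: flat_def)
  show "w = join d 0 b" if v0: "w \<in> intern flat \<and> (\<exists>v\<in>phys flat. join d a b = v + w)" for w
  proof -
    obtain v b' where v: "v \<in> topspace (Euclidean_space d)" "join d a b = v + join d 0 b'" "w = join d 0 b'"
      using v0 by (auto simp: flat_def)
    then have "join d a b = join d v b'" by (simp add: join_split)
    then have "b = b'" unfolding join_inject[OF assms(1) v(1)] ..
    then show ?thesis using v(3) by simp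
  qed
qed

lemma join_0_inj: "inj (join d 0)"
  using join_inject[of 0 d 0] add_subgroupD(1)[OF add_subgroup_Euclidean_space[of d]] by (auto simp: inj_def)

text \<open>A lattice point avoids all frontiers, so it lies in exactly one cell, that of the slices
  containing it. If no slice contains it, this is the cell of the empty set, which is not a
  colour.\<close>

lemma cut_project_set_flat:
  "cut_project_set flat = {(a, enc (visible b)) | a b. (a, b) \<in> reduced \<and> visible b \<noteq> {}}"
proof -
  have "cut_project_set flat =
      {(a, k) | a b k. (a, b) \<in> reduced \<and> k \<in> enc ` (Pow J - {{}}) \<and> b \<in> cell (the_inv_into (Pow J) enc k)}"
  proof -
    have 1: "coord flat (proj_phys flat (join d a b)) = a"
      "proj_int flat (join d a b) \<in> window flat k \<longleftrightarrow> b \<in> cell (the_inv_into (Pow J) enc k)"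
      if "(a, b) \<in> reduced" for a b k
      using flat_proj_phys flat_proj_int reduced_D[OF that] join_0_inj
      by (auto simp: flat_def inj_image_mem_iff)
    have 2: "lattice flat = (\<lambda>(a, b). join d a b) ` reduced" "colours flat = enc ` (Pow J - {{}})"
      by (simp_all add: flat_def)
    show ?thesis
      unfolding cut_project_set_def 2 using 1 by fastforce
  qed
  also have "\<dots> = {(a, enc (visible b)) | a b. (a, b) \<in> reduced \<and> visible b \<noteq> {}}"
  proof -
    have sub: "visible b \<subseteq> J" for b by (auto simp: visible_def)
    have "k \<in> enc ` (Pow J - {{}}) \<and> b \<in> cell (the_inv_into (Pow J) enc k) \<longleftrightarrow>
        k = enc (visible b) \<and> visible b \<noteq> {}" if ab: "(a, b) \<in> reduced" for a b k
    proof
      assume "k \<in> enc ` (Pow J - {{}}) \<and> b \<in> cell (the_inv_into (Pow J) enc k)"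
      then obtain A where A: "A \<subseteq> J" "A \<noteq> {}" "k = enc A" "b \<in> cell (the_inv_into (Pow J) enc k)" by blast
      then have "b \<in> cell A" using enc_inverse by simp
      then have "A = visible b" using in_cell_iff[OF ab A(1)] by blast
      with A show "k = enc (visible b) \<and> visible b \<noteq> {}" by blast
    next
      assume k: "k = enc (visible b) \<and> visible b \<noteq> {}"
      then have "b \<in> cell (visible b)" using in_cell_iff[OF ab sub] by blast
      then show "k \<in> enc ` (Pow J - {{}}) \<and> b \<in> cell (the_inv_into (Pow J) enc k)"
        using k enc_inverse[OF sub] sub by auto
    qed
    then show ?thesis by blast
  qed
  finally show ?thesis .
qed

section \<open>Mutual local derivability\<close>

definition points :: "((nat \<Rightarrow> real) \<times> 'c) set" where
  "points = {(a, i) | a b c i. (a, b, c) \<in> L \<and> i \<in> I \<and> b \<in> w i c}"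

text \<open>The physical part determines the lattice point, so membership may be tested at any given
  witness.\<close>

lemma mem_points_iff:
  assumes "(a, b, c) \<in> L"
  shows "(a, i) \<in> points \<longleftrightarrow> i \<in> I \<and> b \<in> w i c"
  using assms unfolding points_def by (auto dest: L_unique[OF assms])

text \<open>The dictionary between new colours and old points: adding the representative over
  \<open>c\<close> leads from the period \<open>s\<close> to the component \<open>s + c\<close>,
  whose slices are those over \<open>c\<close>.\<close>

lemma mem_visible_iff:
  assumes "(a, b, s) \<in> L" "s \<in> periods" "(i, c) \<in> J"
  shows "(i, c) \<in> visible b \<longleftrightarrow> (a + \<alpha> c, i) \<in> points"
proof -
  have "(a + \<alpha> c, b + \<beta> c, s + c) \<in> L" using L_add[OF assms(1) representatives] assms(3) by blast
  then show ?thesis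
    using assms mem_U[OF assms(3) L_D(2)[OF assms(1)]] by (simp add: mem_points_iff w_period visible_def)
qed

text \<open>Subtracting \<open>\<alpha> c\<close> from an old point over \<open>c\<close> gives a
  new point whose colour contains \<open>(i, c)\<close>. The same colour occurs at
  \<open>y - \<alpha> c\<close>, and the dictionary leads back to an old point at
  \<open>y\<close>.\<close>

lemma points_derivable: "locally_derivable_from d points (cut_project_set flat)"
proof (rule locally_derivableI)
  let ?P = "(\<lambda>c. - \<alpha> c) ` support"
  show "finite ?P" using finite_support by (simp add: support_def)
  show "?P \<subseteq> topspace (Euclidean_space d)"
    using L_D(1)[OF representatives] add_subgroupD(3)[OF add_subgroup_Euclidean_space] by blast
  fix x y i
  assume eq: "\<And>p e. p \<in> ?P \<Longrightarrow> (x + p, e) \<in> cut_project_set flat \<longleftrightarrow> (y + p, e) \<in> cut_project_set flat"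
    and "(x, i) \<in> points"
  then obtain b c where x: "(x, b, c) \<in> L" "i \<in> I" "b \<in> w i c" by (auto simp: points_def)
  then have c: "c \<in> support" by (auto simp: support_def)
  then have J: "(i, c) \<in> J" using x by blast
  have "(x - \<alpha> c, b - \<beta> c, 0) \<in> L" using L_diff[OF x(1) representatives[OF c]] by simp
  then have red: "(x - \<alpha> c, b - \<beta> c) \<in> reduced"
    using add_subgroupD(1)[OF periods_subgroup] by (auto simp: reduced_def)
  have vis: "(i, c) \<in> visible (b - \<beta> c)"
    using J x(3) mem_U[OF J reduced_D(2)[OF red]] by (simp add: visible_def)
  then have "(x + - \<alpha> c, enc (visible (b - \<beta> c))) \<in> cut_project_set flat"
    using red by (auto simp: cut_project_set_flat)
  then have "(y + - \<alpha> c, enc (visible (b - \<beta> c))) \<in> cut_project_set flat"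
    using eq c by blast
  then obtain b' where b': "(y - \<alpha> c, b') \<in> reduced" "enc (visible (b - \<beta> c)) = enc (visible b')"
    by (auto simp: cut_project_set_flat)
  moreover have "visible b' \<subseteq> J" "visible (b - \<beta> c) \<subseteq> J" by (auto simp: visible_def)
  ultimately have "(i, c) \<in> visible b'"
    using vis inj_onD[OF enc_inj, of "visible (b - \<beta> c)" "visible b'"] by blast
  moreover obtain s where "s \<in> periods" "(y - \<alpha> c, b', s) \<in> L" using b'(1) by (auto simp: reduced_def)
  ultimately show "(y, i) \<in> points"
    using mem_visible_iff[of "y - \<alpha> c" b' s i c] J by simp
qed

text \<open>Once \<open>y\<close> is known to be the physical part of a lattice point over a period,
  the dictionary gives its colour. An old point at \<open>y + \<alpha> c\<close> supplies a lattice
  point over some \<open>c'\<close>, and the separating set forces \<open>c'\<close> to agree modulo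
  periods with the component at \<open>x + \<alpha> c\<close>.\<close>

lemma flat_derivable: "locally_derivable_from d (cut_project_set flat) points"
proof -
  obtain F where F: "finite F" "F \<subseteq> L"
    and sep: "\<And>i i' c c' b b'. i \<in> I \<Longrightarrow> i' \<in> I \<Longrightarrow> b \<in> w i c \<Longrightarrow> b' \<in> w i' c' \<Longrightarrow>
      c' - c \<notin> periods \<Longrightarrow> separates F b c b' c'"
    using windows_uniformly_separated by metis
  \<comment> \<open>The vectors \<open>\<alpha> c\<close> read off the colours; the vectors
    \<open>\<alpha> c + fst \<delta>\<close> compare the surroundings of the old points at
    \<open>x + \<alpha> c\<close> and \<open>y + \<alpha> c\<close>.\<close>
  define P where "P = \<alpha> ` support \<union> (\<lambda>(c, \<delta>). \<alpha> c + fst \<delta>) ` (support \<times> F)"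
  show ?thesis
  proof (rule locally_derivableI)
    show "finite P" using finite_support F(1) by (simp add: support_def P_def)
    show "P \<subseteq> topspace (Euclidean_space d)"
      using L_D(1)[OF representatives] L_D(1) F(2) add_subgroupD(2)[OF add_subgroup_Euclidean_space]
      unfolding P_def by fastforce
    fix x y k
    assume eq: "\<And>p e. p \<in> P \<Longrightarrow> (x + p, e) \<in> points \<longleftrightarrow> (y + p, e) \<in> points"
      and "(x, k) \<in> cut_project_set flat"
    then obtain b s where x: "k = enc (visible b)" "visible b \<noteq> {}" "(x, b, s) \<in> L" "s \<in> periods"
      by (auto simp: cut_project_set_flat reduced_def)
    then obtain i c where ic: "(i, c) \<in> visible b" by auto
    then have J: "(i, c) \<in> J" by (simp add: visible_def)
    then have c: "c \<in> support" and i: "i \<in> I" by auto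
    have xL: "(x + \<alpha> c, b + \<beta> c, s + c) \<in> L" using L_add[OF x(3) representatives[OF c]] .
    have x_point: "(x + \<alpha> c, i) \<in> points" using mem_visible_iff[OF x(3,4) J] ic by blast
    then have "(y + \<alpha> c, i) \<in> points" using eq[of "\<alpha> c"] c by (auto simp: P_def)
    then obtain b' c' where yL: "(y + \<alpha> c, b', c') \<in> L" "b' \<in> w i c'" by (auto simp: points_def)
    have "b + \<beta> c \<in> w i (s + c)" using x_point mem_points_iff[OF xL] by blast
    have "c' - (s + c) \<in> periods"
    proof (rule ccontr)
      assume "c' - (s + c) \<notin> periods"
      then have "separates F (b + \<beta> c) (s + c) b' c'"
        using sep[OF i i \<open>b + \<beta> c \<in> w i (s + c)\<close> yL(2)] by blast
      then obtain a0 b0 k0 j where \<delta>: "(a0, b0, k0) \<in> F" "j \<in> I"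
        "b + \<beta> c + b0 \<in> w j (s + c + k0) \<longleftrightarrow> b' + b0 \<notin> w j (c' + k0)"
        unfolding separates_def by blast
      then have "(a0, b0, k0) \<in> L" using F(2) by blast
      from mem_points_iff[OF L_add[OF xL this], of j] mem_points_iff[OF L_add[OF yL(1) this], of j] \<delta>
      have "(x + \<alpha> c + a0, j) \<in> points \<longleftrightarrow> (y + \<alpha> c + a0, j) \<notin> points" by blast
      moreover have "\<alpha> c + a0 \<in> P" using \<delta>(1) c unfolding P_def by force
      ultimately show False using eq[of "\<alpha> c + a0" j] by (simp add: add.assoc)
    qed
    \<comment> \<open>\<open>c' - c\<close> is the component left at \<open>y\<close> after removing
      the representative over \<open>c\<close>; it is a period because \<open>s\<close> is
      one.\<close>
    then have "(c' - (s + c)) + s \<in> periods"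
      using x(4) add_subgroupD(2)[OF periods_subgroup] by blast
    then have s': "c' - c \<in> periods" by simp
    have yL': "(y, b' - \<beta> c, c' - c) \<in> L" using L_diff[OF yL(1) representatives[OF c]] by simp
    have "(i2, c2) \<in> visible (b' - \<beta> c) \<longleftrightarrow> (i2, c2) \<in> visible b" if "(i2, c2) \<in> J" for i2 c2
      using mem_visible_iff[OF yL' s' that] mem_visible_iff[OF x(3,4) that] eq[of "\<alpha> c2" i2] that
      by (auto simp: P_def)
    then have "visible (b' - \<beta> c) = visible b" unfolding visible_def by blast
    moreover have "(y, b' - \<beta> c) \<in> reduced" using yL' s' by (auto simp: reduced_def)
    ultimately show "(y, k) \<in> cut_project_set flat"
      unfolding cut_project_set_flat using x(1,2) by force
  qed
qed

section \<open>The axioms for the new scheme\<close>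

lemma flat_int_top:
  "int_top flat = subtopology (Euclidean_space (d + n)) (join d 0 ` topspace (Euclidean_space n))"
  by (simp add: flat_def)

lemma homeomorphic_map_flat: "homeomorphic_map (Euclidean_space n) (int_top flat) (join d 0)"
  unfolding flat_int_top by (rule homeomorphic_map_join_right)

lemma topspace_int_top_flat: "topspace (int_top flat) = intern flat"
proof -
  have "intern flat = join d 0 ` topspace (Euclidean_space n)" by (simp add: flat_def)
  then show ?thesis
    unfolding homeomorphic_imp_surjective_map[OF homeomorphic_map_flat] ..
qed

lemma cell_subset: "A \<subseteq> J \<Longrightarrow> cell A \<subseteq> topspace (Euclidean_space n)"
  by (simp add: overlay_cell_def closure_of_subset_topspace)

text \<open>A cell lies in each slice of its index set and inherits compactness. This is why the
  empty set, whose cell lies outside the slices, is excluded as a colour.\<close>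

lemma cell_compact:
  assumes "A \<subseteq> J" "A \<noteq> {}"
  shows "compactin (Euclidean_space n) (cell A)"
proof -
  obtain j where "j \<in> A" using assms(2) by blast
  have "j \<in> J" by (rule subsetD[OF assms(1) \<open>j \<in> A\<close>])
  moreover have "cell A \<subseteq> U j"
    by (rule overlay_cell_subset[OF finite_J U_closed assms(1) \<open>j \<in> A\<close>])
  moreover have "closedin (Euclidean_space n) (cell A)" by (simp add: overlay_cell_def)
  ultimately show ?thesis by (rule closed_compactin[OF U_compact])
qed

lemma flat_windowE:
  assumes "k \<in> colours flat"
  obtains A where "A \<subseteq> J" "A \<noteq> {}" "k = enc A" "window flat k = join d 0 ` cell A"
proof -
  obtain A where A: "A \<subseteq> J" "A \<noteq> {}" "k = enc A" using assms by (auto simp: flat_def)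
  then have "window flat k = join d 0 ` cell A"
    using enc_inverse by (simp add: flat_def)
  with A that show thesis by blast
qed

lemma flat_window_frontier:
  "A \<subseteq> J \<Longrightarrow> int_top flat frontier_of (join d 0 ` cell A) = join d 0 ` (Euclidean_space n frontier_of cell A)"
  by (rule homeomorphic_map_frontier_of[OF homeomorphic_map_flat cell_subset])

text \<open>A single cell may be empty; the definition asks only that the union of the windows is
  not.\<close>

lemma flat_admissible: "admissible_window flat"
  unfolding admissible_window_def
proof (intro conjI ballI impI)
  show "finite (colours flat)" using finite_J by (simp add: flat_def)
  obtain a b where b: "(a, b) \<in> reduced" "visible b \<noteq> {}" using exists_visible by blast
  have vis: "visible b \<subseteq> J" by (auto simp: visible_def)
  then have "b \<in> cell (visible b)" using in_cell_iff[OF b(1)] by blast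
  moreover have "enc (visible b) \<in> colours flat" using vis b(2) by (auto simp: flat_def)
  moreover have "window flat (enc (visible b)) = join d 0 ` cell (visible b)"
    using enc_inverse[OF vis] by (simp add: flat_def)
  ultimately show "(\<Union>i\<in>colours flat. window flat i) \<noteq> {}" by blast
next
  fix k assume "k \<in> colours flat"
  then obtain A where A: "A \<subseteq> J" "A \<noteq> {}" "window flat k = join d 0 ` cell A"
    by (rule flat_windowE)
  show "compactin (int_top flat) (window flat k)"
    unfolding A(3) by (rule image_compactin[OF cell_compact[OF A(1,2)]
          homeomorphic_imp_continuous_map[OF homeomorphic_map_flat]])
  have "int_top flat closure_of (int_top flat interior_of window flat k) =
      join d 0 ` (Euclidean_space n closure_of (Euclidean_space n interior_of cell A))"
    unfolding A(3) homeomorphic_map_interior_of[OF homeomorphic_map_flat cell_subset[OF A(1)]]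
    by (rule homeomorphic_map_closure_of[OF homeomorphic_map_flat interior_of_subset_topspace])
  also have "\<dots> = window flat k"
    using overlay_cell_regular[OF finite_J U_closed A(1)] A(3) by simp
  finally show "window flat k = int_top flat closure_of (int_top flat interior_of window flat k)" ..
next
  fix k l assume "k \<in> colours flat" "l \<in> colours flat" "k \<noteq> l"
  obtain A where A: "A \<subseteq> J" "k = enc A" "window flat k = join d 0 ` cell A"
    using \<open>k \<in> colours flat\<close> by (rule flat_windowE)
  obtain B where B: "B \<subseteq> J" "l = enc B" "window flat l = join d 0 ` cell B"
    using \<open>l \<in> colours flat\<close> by (rule flat_windowE)
  have "A \<noteq> B" using A B \<open>k \<noteq> l\<close> by blast
  then show "window flat k \<inter> window flat l
      \<subseteq> int_top flat frontier_of window flat k \<inter> int_top flat frontier_of window flat l"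
    unfolding A(3) B(3) flat_window_frontier[OF A(1)] flat_window_frontier[OF B(1)]
      image_Int[OF join_0_inj, symmetric]
    by (intro image_mono overlay_cell_Int[OF finite_J U_closed A(1) B(1)])
qed

lemma join_0_add: "join d 0 (x + y) = join d 0 x + join d 0 y"
  using join_add[of d 0 0 x y] by simp

lemma flat_intern_iso: "top_group_iso (Euclidean_space n) (int_top flat) (join d 0)"
  unfolding top_group_iso_def topspace_int_top_flat
proof (intro conjI ballI)
  have "intern flat = join d 0 ` topspace (Euclidean_space n)" by (simp add: flat_def)
  then show "add_subgroup (intern flat)"
    by (simp add: add_subgroup_image add_subgroup_Euclidean_space join_0_add)
qed (rule add_subgroup_Euclidean_space homeomorphic_map_flat join_0_add)+

lemma flat_intern_closed: "closedin (Euclidean_space (d + n)) (intern flat)"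
proof -
  have "0 \<in> topspace (Euclidean_space d)" by (rule add_subgroupD(1)[OF add_subgroup_Euclidean_space])
  then have "closedin ES ({0} \<times> topspace (Euclidean_space n))"
    by (simp add: closedin_prod_Times_iff closedin_Hausdorff_singleton[OF Hausdorff_Euclidean_space])
  then have "closedin (Euclidean_space (d + n)) ((\<lambda>(a, b). join d a b) ` ({0} \<times> topspace (Euclidean_space n)))"
    using homeomorphic_map_closedness_eq[OF homeomorphic_map_join] by blast
  moreover have "(\<lambda>(a, b). join d a b) ` ({0} \<times> topspace (Euclidean_space n)) = intern flat"
    by (force simp: flat_def)
  ultimately show ?thesis by simp
qed

lemma flat_dense: "int_top flat closure_of (proj_int flat ` lattice flat) = intern flat"
proof -
  have "proj_int flat ` lattice flat = join d 0 ` snd ` reduced"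
    unfolding image_image using flat_proj_int reduced_D
    by (auto simp: flat_def image_image intro!: image_cong)
  moreover have "snd ` reduced \<subseteq> topspace (Euclidean_space n)" using reduced_D by auto
  moreover have "Euclidean_space n closure_of (snd ` reduced) = topspace (Euclidean_space n)"
  proof (rule subset_antisym[OF closure_of_subset_topspace subsetI])
    show "x \<in> Euclidean_space n closure_of (snd ` reduced)" if "x \<in> topspace (Euclidean_space n)" for x
      unfolding in_closure_of using that reduced_dense by (force simp: image_iff)
  qed
  ultimately show ?thesis
    using homeomorphic_map_closure_of[OF homeomorphic_map_flat, of "snd ` reduced"] by (simp add: flat_def)
qed

lemma flat_scheme: "cut_project_scheme d n {0::int} 0 flat"
  unfolding cut_project_scheme_def
proof (intro conjI ballI)
  have tot: "total flat = Euclidean_space (d + n)" and ph: "phys flat = topspace (Euclidean_space d)"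
    by (simp_all add: flat_def)
  have dn: "topspace (Euclidean_space d) \<subseteq> topspace (Euclidean_space (d + n))" by simp
  show "finite {0::int}" by simp
  show "add_subgroup {0::int}" by (simp add: add_subgroup_def)
  show "top_group_isomorphic (total flat) (model_space (d + n) {0::int} 0)"
    unfolding tot by (rule Euclidean_space_isomorphic_model)
  show "add_subgroup (phys flat)" unfolding ph by (rule add_subgroup_Euclidean_space)
  show "closedin (total flat) (phys flat)"
    unfolding tot ph closedin_Euclidean_space_iff
    using dn closedin_Euclidean_imp_closed[OF closedin_topspace] by blast
  \<comment> \<open>Both are subspaces of the same power of the reals, so the identity serves as
    \<open>coord\<close>.\<close>
  have phys_top: "phys_top flat = Euclidean_space d"
    unfolding tot ph
    by (auto simp: Euclidean_space_def subtopology_subtopology intro!: arg_cong[where f = "subtopology _"])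
  show "top_group_iso (phys_top flat) (Euclidean_space d) (coord flat)"
    unfolding phys_top top_group_iso_def using add_subgroup_Euclidean_space[of d]
    by (simp add: flat_def)
  show "add_subgroup (intern flat)"
    using flat_intern_iso unfolding top_group_iso_def topspace_int_top_flat by blast
  show "closedin (total flat) (intern flat)" unfolding tot by (rule flat_intern_closed)
  show "top_group_isomorphic (int_top flat) (model_space n {0::int} 0)"
    using top_group_isomorphic_trans[OF top_group_isomorphic_sym Euclidean_space_isomorphic_model]
      flat_intern_iso unfolding top_group_isomorphic_def by blast
  show "phys flat \<inter> intern flat = {0}"
  proof -
    have "a = 0" if "a \<in> topspace (Euclidean_space d)" "a = join d 0 b" for a b
      using join_inject[OF that(1), of 0 0 b] join_left[OF that(1)] that(2)
        add_subgroupD(1)[OF add_subgroup_Euclidean_space[of d]] by (simp add: join_0)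
    moreover have "0 \<in> join d 0 ` topspace (Euclidean_space n)"
      using imageI[OF add_subgroupD(1)[OF add_subgroup_Euclidean_space[of n]], of "join d 0"]
      unfolding join_0 .
    moreover have "intern flat = join d 0 ` topspace (Euclidean_space n)" by (simp add: flat_def)
    ultimately show ?thesis
      unfolding ph using add_subgroupD(1)[OF add_subgroup_Euclidean_space[of d]] by blast
  qed
  show "topspace (total flat) = {v + w |v w. v \<in> phys flat \<and> w \<in> intern flat}"
  proof (intro subset_antisym subsetI)
    fix x assume "x \<in> topspace (total flat)"
    then obtain a b where ab: "a \<in> topspace (Euclidean_space d)" "b \<in> topspace (Euclidean_space n)" "x = join d a b"
      unfolding tot by (rule join_surj)
    have "join d 0 b \<in> intern flat" using ab(2) by (simp add: flat_def)
    then show "x \<in> {v + w |v w. v \<in> phys flat \<and> w \<in> intern flat}"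
      unfolding ab(3) join_split[OF ab(1)] ph using ab(1) by blast
  next
    fix x assume "x \<in> {v + w |v w. v \<in> phys flat \<and> w \<in> intern flat}"
    then obtain a b where "a \<in> topspace (Euclidean_space d)" "b \<in> topspace (Euclidean_space n)" "x = a + join d 0 b"
      by (auto simp: flat_def)
    then show "x \<in> topspace (total flat)"
      unfolding tot using join_split[of a d b] join_in[of a d b n] by simp
  qed
  show "discrete_cocompact_subgroup (total flat) (lattice flat)"
    using flat_lattice by (simp add: flat_def)
  show "admissible_window flat" by (rule flat_admissible)
  have lat: "lattice flat = (\<lambda>(a, b). join d a b) ` reduced" by (simp add: flat_def)
  have diff: "(a - a', b - b') \<in> reduced" if "(a, b) \<in> reduced" "(a', b') \<in> reduced" for a b a' b'
    using add_subgroupD(4)[OF reduced_subgroup that] by simp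
  show "inj_on (proj_phys flat) (lattice flat)"
  proof (rule inj_onI)
    fix x y assume "x \<in> lattice flat" "y \<in> lattice flat" and eq: "proj_phys flat x = proj_phys flat y"
    then obtain a b a' b' where *: "(a, b) \<in> reduced" "(a', b') \<in> reduced" "x = join d a b" "y = join d a' b'"
      unfolding lat by auto
    then have "a = a'" using eq flat_proj_phys reduced_D by simp
    then show "x = y" using diff[OF *(1,2)] reduced_inj(1)[of "b - b'"] * by simp
  qed
  show "inj_on (proj_int flat) (lattice flat)"
  proof (rule inj_onI)
    fix x y assume "x \<in> lattice flat" "y \<in> lattice flat" and eq: "proj_int flat x = proj_int flat y"
    then obtain a b a' b' where *: "(a, b) \<in> reduced" "(a', b') \<in> reduced" "x = join d a b" "y = join d a' b'"
      unfolding lat by auto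
    then have "b = b'" using eq flat_proj_int reduced_D injD[OF join_0_inj] by simp
    then show "x = y" using diff[OF *(1,2)] reduced_inj(2)[of "a - a'"] * by simp
  qed
  show "int_top flat closure_of (proj_int flat ` lattice flat) = intern flat" by (rule flat_dense)
  fix \<gamma> k assume "\<gamma> \<in> lattice flat" "k \<in> colours flat"
  then obtain a b where ab: "(a, b) \<in> reduced" "\<gamma> = join d a b" unfolding lat by auto
  obtain A where A: "A \<subseteq> J" "window flat k = join d 0 ` cell A"
    using \<open>k \<in> colours flat\<close> by (rule flat_windowE)
  have "proj_int flat \<gamma> = join d 0 b" using ab flat_proj_int reduced_D by simp
  then show "proj_int flat \<gamma> \<notin> int_top flat frontier_of window flat k"
    unfolding A(2) flat_window_frontier[OF A(1)]
    using cell_nonsingular[OF ab(1) A(1)] by (simp add: inj_image_mem_iff[OF join_0_inj])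
qed

end

text \<open>The data of \<open>overlay_scheme\<close> exist: density gives a lattice point over
  every component, and the finitely many sets of slices can be numbered.\<close>

lemma (in sliced_scheme) exists_flat_scheme:
  "\<exists>S' :: (nat \<Rightarrow> real, nat) cut_project. cut_project_scheme d n {0::int} 0 S' \<and>
     MLD d {(a, i) | a b c i. (a, b, c) \<in> L \<and> i \<in> I \<and> b \<in> w i c} (cut_project_set S')"
proof -
  have "\<exists>a b. (a, b, c) \<in> L" if c: "c \<in> support" for c
  proof -
    obtain i where "i \<in> I" "w i c \<noteq> {}" using c unfolding support_def by blast
    then have "c \<in> C" by (rule w_support)
    moreover have "topspace (Euclidean_space n) \<noteq> {}"
      using add_subgroupD(1)[OF add_subgroup_Euclidean_space[of n]] by auto
    ultimately obtain a b where "(a, b, c) \<in> L" using L_dense[OF _ openin_topspace] by blast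
    then show ?thesis by blast
  qed
  then obtain \<alpha> \<beta> where rep: "\<And>c. c \<in> support \<Longrightarrow> (\<alpha> c, \<beta> c, c) \<in> L" by metis
  have "finite (Pow (I \<times> support))" using finite_I finite_support by (simp add: support_def)
  then obtain enc :: "('c \<times> 'k) set \<Rightarrow> nat" where enc: "inj_on enc (Pow (I \<times> support))"
    using finite_imp_inj_to_nat_seg by metis
  have ov: "overlay_scheme d n C L I w \<alpha> \<beta> enc"
    by (rule overlay_scheme.intro[OF sliced_scheme_axioms overlay_scheme_axioms.intro[OF rep enc]])
  have "MLD d (overlay_scheme.points L I w) (cut_project_set (overlay_scheme.flat d n C L I w \<beta> enc))"
    unfolding MLD_def
    by (rule conjI overlay_scheme.flat_derivable[OF ov] overlay_scheme.points_derivable[OF ov])+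
  then show ?thesis
    unfolding overlay_scheme.points_def[OF ov] using overlay_scheme.flat_scheme[OF ov] by blast
qed

subsection \<open>Coordinates on a cut and project scheme\<close>

text \<open>Makes the cover in Baire's theorem countable; integer vectors are parametrised by finite
  lists.\<close>

lemma countable_int_vectors: "countable {z :: nat \<Rightarrow> int. \<forall>i\<ge>r. z i = 0}"
proof (rule countable_subset)
  let ?f = "\<lambda>xs i. if i < r then xs ! i else (0::int)"
  show "{z :: nat \<Rightarrow> int. \<forall>i\<ge>r. z i = 0} \<subseteq> range ?f"
  proof
    fix z :: "nat \<Rightarrow> int" assume "z \<in> {z. \<forall>i\<ge>r. z i = 0}"
    then have "z = ?f (map z [0..<r])" by (auto simp: fun_eq_iff)
    then show "z \<in> range ?f" by blast
  qed
qed simp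

definition discrete_part :: "'g::ab_group_add set \<Rightarrow> nat \<Rightarrow> ('g \<times> (nat \<Rightarrow> int)) set" where
  "discrete_part G r = G \<times> {z. \<forall>i\<ge>r. z i = 0}"

lemma model_space_eq:
  "model_space m G r = prod_topology (Euclidean_space m) (discrete_topology (discrete_part G r))"
  by (simp add: model_space_def discrete_part_def prod_topology_discrete_topology)

lemma topspace_model_space: "topspace (model_space m G r) = topspace (Euclidean_space m) \<times> discrete_part G r"
  by (simp add: model_space_eq)

lemma discrete_part_subgroup: "add_subgroup G \<Longrightarrow> add_subgroup (discrete_part G r)"
  unfolding discrete_part_def by (intro add_subgroup_Times) (auto simp: add_subgroup_def)

lemma countable_discrete_part: "finite G \<Longrightarrow> countable (discrete_part G r)"
  unfolding discrete_part_def by (intro countable_SIGMA countable_finite countable_int_vectors)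

lemma topological_group_on_model_space: "add_subgroup G \<Longrightarrow> topological_group_on (model_space m G r)"
  unfolding model_space_eq
  by (intro topological_group_on_prod topological_group_on_Euclidean_space
      topological_group_on_discrete discrete_part_subgroup)

text \<open>Completeness, carried over to the total space, makes Baire's theorem available
  there.\<close>

lemma completely_metrizable_model_space: "completely_metrizable_space (model_space m G r)"
  unfolding model_space_eq
  by (simp add: completely_metrizable_space_prod_topology completely_metrizable_Euclidean_space
      completely_metrizable_space_discrete_topology)

text \<open>The isomorphism of the total space with its model need not respect the splitting, so
  coordinates are taken on the two factors. \<psi> and \<sigma> are the inverse charts.\<close>

locale charted_scheme =
  fixes d n :: nat and G :: "'g::ab_group_add set" and r :: nat
    and S :: "('a::ab_group_add, 'c) cut_project"
    and \<phi> :: "'a \<Rightarrow> (nat \<Rightarrow> real) \<times> 'g \<times> (nat \<Rightarrow> int)" and \<psi> and \<sigma>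
  assumes scheme: "cut_project_scheme d n G r S"
    and int_chart: "homeomorphic_maps (int_top S) (model_space n G r) \<phi> \<psi>"
    and phys_chart: "homeomorphic_maps (phys_top S) (Euclidean_space d) (coord S) \<sigma>"
    and int_chart_add: "\<And>x y. x \<in> topspace (int_top S) \<Longrightarrow> y \<in> topspace (int_top S) \<Longrightarrow> \<phi> (x + y) = \<phi> x + \<phi> y"
begin

abbreviation "C \<equiv> discrete_part G r"
abbreviation "M \<equiv> model_space n G r"

definition chart :: "'a \<Rightarrow> (nat \<Rightarrow> real) \<times> (nat \<Rightarrow> real) \<times> 'g \<times> (nat \<Rightarrow> int)" where
  "chart x = (coord S (proj_phys S x), \<phi> (proj_int S x))"

text \<open>The inverse of \<open>chart\<close>. It is continuous because addition is, and
  topological facts about the lattice are carried over through \<theta> rather than through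
  \<open>chart\<close>.\<close>

definition \<theta> :: "(nat \<Rightarrow> real) \<times> (nat \<Rightarrow> real) \<times> 'g \<times> (nat \<Rightarrow> int) \<Rightarrow> 'a" where
  "\<theta> p = \<sigma> (fst p) + \<psi> (snd p)"

definition L where "L = chart ` lattice S"

text \<open>\<psi> is arbitrary off the model space; the condition \<open>c \<in> C\<close> makes
  slices over other \<open>c\<close> empty by default.\<close>

definition slice :: "'c \<Rightarrow> 'g \<times> (nat \<Rightarrow> int) \<Rightarrow> (nat \<Rightarrow> real) set" where
  "slice i c = {b \<in> topspace (Euclidean_space n). c \<in> C \<and> \<psi> (b, c) \<in> window S i}"

lemma
  shows G: "finite G" "add_subgroup G"
    and total_iso: "top_group_isomorphic (total S) (model_space (d + n) G r)"
    and phys_subgroup: "add_subgroup (phys S)"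
    and intern_subgroup: "add_subgroup (intern S)"
    and disjoint: "phys S \<inter> intern S = {0}"
    and total_sum: "topspace (total S) = {v + w | v w. v \<in> phys S \<and> w \<in> intern S}"
    and lattice_S: "discrete_cocompact_subgroup (total S) (lattice S)"
    and admissible: "admissible_window S"
    and inj_phys: "inj_on (proj_phys S) (lattice S)"
    and inj_int: "inj_on (proj_int S) (lattice S)"
    and dense: "int_top S closure_of (proj_int S ` lattice S) = intern S"
  using scheme unfolding cut_project_scheme_def by - (elim conjE, assumption)+

lemma nonsingular:
  assumes "\<gamma> \<in> lattice S" "i \<in> colours S"
  shows "proj_int S \<gamma> \<notin> int_top S frontier_of window S i"
proof -
  have "\<forall>\<gamma>\<in>lattice S. \<forall>i\<in>colours S. proj_int S \<gamma> \<notin> int_top S frontier_of window S i"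
    using scheme unfolding cut_project_scheme_def by (elim conjE)
  then show ?thesis using assms by blast
qed

lemma coord_add:
  assumes "x \<in> topspace (phys_top S)" "y \<in> topspace (phys_top S)"
  shows "coord S (x + y) = coord S x + coord S y"
proof -
  have "top_group_iso (phys_top S) (Euclidean_space d) (coord S)"
    using scheme unfolding cut_project_scheme_def by (elim conjE)
  then show ?thesis using assms unfolding top_group_iso_def by blast
qed

section \<open>The total space and its two projections\<close>

lemma C_group: "add_subgroup C"
  using G(2) by (rule discrete_part_subgroup)

lemma phys_subset: "phys S \<subseteq> topspace (total S)" and intern_subset: "intern S \<subseteq> topspace (total S)"
proof -
  have 0: "0 \<in> phys S" "0 \<in> intern S" using disjoint by blast+
  show "phys S \<subseteq> topspace (total S)"
  proof
    fix x assume "x \<in> phys S"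
    then have "x + 0 \<in> topspace (total S)" unfolding total_sum using 0 by blast
    then show "x \<in> topspace (total S)" by simp
  qed
  show "intern S \<subseteq> topspace (total S)"
  proof
    fix x assume "x \<in> intern S"
    then have "0 + x \<in> topspace (total S)" unfolding total_sum using 0 by blast
    then show "x \<in> topspace (total S)" by simp
  qed
qed

lemma topspace_phys_top: "topspace (phys_top S) = phys S"
  using phys_subset by auto

lemma topspace_int_top: "topspace (int_top S) = intern S"
  using intern_subset by auto

lemma total_group: "topological_group_on (total S)"
proof -
  obtain f where "top_group_iso (total S) (model_space (d + n) G r) f"
    using total_iso by (auto simp: top_group_isomorphic_def)
  then show ?thesis
    by (rule topological_group_on_iso) (rule topological_group_on_model_space[OF G(2)])
qed

lemma total_subgroup: "add_subgroup (topspace (total S))"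
  using total_group by (simp add: topological_group_on_def)

lemma lattice_subset: "lattice S \<subseteq> topspace (total S)"
  and lattice_subgroup: "add_subgroup (lattice S)"
  using lattice_S by (auto simp: discrete_cocompact_subgroup_def)

lemma total_completely_metrizable: "completely_metrizable_space (total S)"
proof -
  obtain f where "top_group_iso (total S) (model_space (d + n) G r) f"
    using total_iso by (auto simp: top_group_isomorphic_def)
  then have "total S homeomorphic_space model_space (d + n) G r"
    unfolding top_group_iso_def by (blast intro: homeomorphic_map_imp_homeomorphic_space)
  then show ?thesis
    using homeomorphic_completely_metrizable_space completely_metrizable_model_space by blast
qed

lemma decomposition_unique:
  assumes "v \<in> phys S" "w \<in> intern S" "v' \<in> phys S" "w' \<in> intern S" "v + w = v' + w'"
  shows "v = v'" "w = w'"
proof -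
  have "v - v' = w' - w" using assms(5) by (simp add: algebra_simps)
  moreover have "v - v' \<in> phys S" "w' - w \<in> intern S"
    using assms add_subgroupD(4)[OF phys_subgroup] add_subgroupD(4)[OF intern_subgroup] by blast+
  ultimately have "v - v' \<in> phys S \<inter> intern S" by simp
  then have "v = v'" unfolding disjoint by simp
  then show "v = v'" "w = w'" using assms(5) by simp_all
qed

lemma proj_sum:
  assumes "v \<in> phys S" "w \<in> intern S"
  shows "proj_phys S (v + w) = v" "proj_int S (v + w) = w"
proof -
  show "proj_phys S (v + w) = v"
    unfolding proj_phys_def
    by (rule the_equality) (use assms decomposition_unique(1) in blast)+
  show "proj_int S (v + w) = w"
    unfolding proj_int_def
    by (rule the_equality) (use assms decomposition_unique(2) in blast)+
qed

lemma proj_decomposition: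
  assumes "x \<in> topspace (total S)"
  shows "proj_phys S x \<in> phys S" "proj_int S x \<in> intern S" "x = proj_phys S x + proj_int S x"
proof -
  obtain v w where vw: "v \<in> phys S" "w \<in> intern S" "x = v + w"
    using assms unfolding total_sum by blast
  show "proj_phys S x \<in> phys S" "proj_int S x \<in> intern S" "x = proj_phys S x + proj_int S x"
    using vw by (simp_all add: proj_sum)
qed

lemma proj_add:
  assumes "x \<in> topspace (total S)" "y \<in> topspace (total S)"
  shows "proj_phys S (x + y) = proj_phys S x + proj_phys S y"
    "proj_int S (x + y) = proj_int S x + proj_int S y"
proof -
  note x = proj_decomposition[OF assms(1)] and y = proj_decomposition[OF assms(2)]
  have "(proj_phys S x + proj_phys S y) + (proj_int S x + proj_int S y) =
      (proj_phys S x + proj_int S x) + (proj_phys S y + proj_int S y)"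
    by (simp add: ac_simps)
  also have "\<dots> = x + y"
    by (simp only: x(3)[symmetric] y(3)[symmetric])
  finally have eq: "(proj_phys S x + proj_phys S y) + (proj_int S x + proj_int S y) = x + y" .
  show "proj_phys S (x + y) = proj_phys S x + proj_phys S y"
    "proj_int S (x + y) = proj_int S x + proj_int S y"
    using proj_sum[OF add_subgroupD(2)[OF phys_subgroup x(1) y(1)]
        add_subgroupD(2)[OF intern_subgroup x(2) y(2)]] unfolding eq by - assumption+
qed

section \<open>Inverse charts\<close>

lemma
  shows \<sigma>_cont: "continuous_map (Euclidean_space d) (phys_top S) \<sigma>"
    and coord_in: "v \<in> phys S \<Longrightarrow> coord S v \<in> topspace (Euclidean_space d)"
    and \<sigma>_in: "a \<in> topspace (Euclidean_space d) \<Longrightarrow> \<sigma> a \<in> phys S"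
    and \<sigma>_coord: "v \<in> phys S \<Longrightarrow> \<sigma> (coord S v) = v"
    and coord_\<sigma>: "a \<in> topspace (Euclidean_space d) \<Longrightarrow> coord S (\<sigma> a) = a"
proof -
  have "continuous_map (phys_top S) (Euclidean_space d) (coord S)"
    using phys_chart by (simp add: homeomorphic_maps_def)
  moreover show "continuous_map (Euclidean_space d) (phys_top S) \<sigma>"
    using phys_chart by (simp add: homeomorphic_maps_def)
  ultimately show "v \<in> phys S \<Longrightarrow> coord S v \<in> topspace (Euclidean_space d)"
    "a \<in> topspace (Euclidean_space d) \<Longrightarrow> \<sigma> a \<in> phys S"
    using continuous_map_image_subset_topspace topspace_phys_top by blast+
  show "v \<in> phys S \<Longrightarrow> \<sigma> (coord S v) = v"
    "a \<in> topspace (Euclidean_space d) \<Longrightarrow> coord S (\<sigma> a) = a"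
    using phys_chart topspace_phys_top unfolding homeomorphic_maps_def by blast+
qed

lemma
  shows \<phi>_cont: "continuous_map (int_top S) M \<phi>"
    and \<psi>_cont: "continuous_map M (int_top S) \<psi>"
    and \<phi>_in: "w \<in> intern S \<Longrightarrow> \<phi> w \<in> topspace (Euclidean_space n) \<times> C"
    and \<psi>_in: "h \<in> topspace (Euclidean_space n) \<times> C \<Longrightarrow> \<psi> h \<in> intern S"
    and \<psi>_\<phi>: "w \<in> intern S \<Longrightarrow> \<psi> (\<phi> w) = w"
    and \<phi>_\<psi>: "h \<in> topspace (Euclidean_space n) \<times> C \<Longrightarrow> \<phi> (\<psi> h) = h"
proof -
  show \<phi>: "continuous_map (int_top S) M \<phi>" and \<psi>: "continuous_map M (int_top S) \<psi>"
    using int_chart by (simp_all add: homeomorphic_maps_def)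
  show "w \<in> intern S \<Longrightarrow> \<phi> w \<in> topspace (Euclidean_space n) \<times> C"
    using subsetD[OF continuous_map_image_subset_topspace[OF \<phi>] imageI, of w]
    unfolding topspace_int_top topspace_model_space .
  show "h \<in> topspace (Euclidean_space n) \<times> C \<Longrightarrow> \<psi> h \<in> intern S"
    using subsetD[OF continuous_map_image_subset_topspace[OF \<psi>] imageI, of h]
    unfolding topspace_int_top topspace_model_space .
  have inv: "\<forall>w\<in>topspace (int_top S). \<psi> (\<phi> w) = w" "\<forall>h\<in>topspace M. \<phi> (\<psi> h) = h"
    using int_chart by (simp_all add: homeomorphic_maps_def)
  show "w \<in> intern S \<Longrightarrow> \<psi> (\<phi> w) = w"
    using bspec[OF inv(1), of w] unfolding topspace_int_top .
  show "h \<in> topspace (Euclidean_space n) \<times> C \<Longrightarrow> \<phi> (\<psi> h) = h"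
    using bspec[OF inv(2), of h] unfolding topspace_model_space .
qed

lemma chart_add:
  assumes "x \<in> topspace (total S)" "y \<in> topspace (total S)"
  shows "chart (x + y) = chart x + chart y"
proof -
  note x = proj_decomposition[OF assms(1)] and y = proj_decomposition[OF assms(2)]
  have "coord S (proj_phys S x + proj_phys S y) = coord S (proj_phys S x) + coord S (proj_phys S y)"
    by (rule coord_add[unfolded topspace_phys_top, OF x(1) y(1)])
  moreover have "\<phi> (proj_int S x + proj_int S y) = \<phi> (proj_int S x) + \<phi> (proj_int S y)"
    by (rule int_chart_add[unfolded topspace_int_top, OF x(2) y(2)])
  ultimately show ?thesis
    unfolding chart_def proj_add[OF assms] by simp
qed

lemma chart_0: "chart 0 = 0"
  by (rule additive_on_0[OF total_subgroup chart_add])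

lemma chart_in: "x \<in> topspace (total S) \<Longrightarrow> chart x \<in> topspace (Euclidean_space d) \<times> topspace (Euclidean_space n) \<times> C"
  unfolding chart_def by (intro SigmaI coord_in \<phi>_in proj_decomposition)

lemma \<theta>_chart: "x \<in> topspace (total S) \<Longrightarrow> \<theta> (chart x) = x"
  unfolding chart_def \<theta>_def using proj_decomposition(1,2)[of x] proj_decomposition(3)[of x, symmetric]
  by (simp add: \<sigma>_coord \<psi>_\<phi>)

lemma
  assumes "p \<in> topspace (Euclidean_space d) \<times> topspace (Euclidean_space n) \<times> C"
  shows \<theta>_in: "\<theta> p \<in> topspace (total S)" and chart_\<theta>: "chart (\<theta> p) = p"
proof -
  have p: "\<sigma> (fst p) \<in> phys S" "\<psi> (snd p) \<in> intern S"
    using assms \<sigma>_in[of "fst p"] \<psi>_in[of "snd p"] by auto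
  then show "\<theta> p \<in> topspace (total S)" unfolding \<theta>_def total_sum by blast
  show "chart (\<theta> p) = p"
    unfolding chart_def \<theta>_def using p assms coord_\<sigma>[of "fst p"] \<phi>_\<psi>[of "snd p"]
    by (simp add: proj_sum mem_Times_iff)
qed

lemma \<theta>_cont: "continuous_map (prod_topology (Euclidean_space d) M) (total S) \<theta>"
proof -
  have "continuous_map (prod_topology (Euclidean_space d) M) (total S) (\<lambda>p. \<sigma> (fst p))"
    using continuous_map_compose[OF continuous_map_fst[of "Euclidean_space d" M] \<sigma>_cont] by (simp add: continuous_map_in_subtopology o_def)
  moreover have "continuous_map (prod_topology (Euclidean_space d) M) (total S) (\<lambda>p. \<psi> (snd p))"
    using continuous_map_compose[OF continuous_map_snd[of "Euclidean_space d" M] \<psi>_cont] by (simp add: continuous_map_in_subtopology o_def)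
  ultimately show ?thesis
    unfolding \<theta>_def by (rule continuous_map_group_add[OF total_group])
qed

section \<open>Slices of the windows\<close>

lemma slice_chart_cont: "c \<in> C \<Longrightarrow> continuous_map (Euclidean_space n) M (\<lambda>b. (b, c))"
  unfolding model_space_eq by (intro continuous_map_pairedI) (auto simp: continuous_map_id[unfolded id_def])

lemma \<psi>_slice_cont: "c \<in> C \<Longrightarrow> continuous_map (Euclidean_space n) (int_top S) (\<lambda>b. \<psi> (b, c))"
  using continuous_map_compose[OF slice_chart_cont \<psi>_cont] by (simp add: o_def)

text \<open>Since \<open>C\<close> is discrete, each component of the internal space is
  open.\<close>

lemma openin_\<psi>_slice:
  assumes "c \<in> C" "openin (Euclidean_space n) O'"
  shows "openin (int_top S) (\<psi> ` (O' \<times> {c}))"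
proof -
  have "openin M (O' \<times> {c})"
    unfolding model_space_eq using assms by (simp add: openin_prod_Times_iff)
  moreover have "homeomorphic_map M (int_top S) \<psi>"
    using int_chart homeomorphic_maps_map by blast
  ultimately show ?thesis using homeomorphic_map_openness openin_subset by blast
qed

lemma
  assumes "i \<in> colours S"
  shows window_compact: "compactin (int_top S) (window S i)"
    and window_regular: "window S i = int_top S closure_of (int_top S interior_of window S i)"
    and window_closed: "closedin (int_top S) (window S i)"
    and window_subset: "window S i \<subseteq> intern S"
proof -
  show 1: "compactin (int_top S) (window S i)"
    and 2: "window S i = int_top S closure_of (int_top S interior_of window S i)"
    using admissible assms unfolding admissible_window_def by blast+
  show "closedin (int_top S) (window S i)" using 2 closedin_closure_of by metis
  show "window S i \<subseteq> intern S" using compactin_subset_topspace[OF 1] topspace_int_top by blast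
qed

lemma slice_closed:
  assumes "i \<in> colours S" "c \<in> C"
  shows "closedin (Euclidean_space n) (slice i c)"
  using closedin_continuous_map_preimage[OF \<psi>_slice_cont[OF assms(2)] window_closed[OF assms(1)]] assms(2)
  by (simp add: slice_def)

lemma slice_interior:
  assumes "c \<in> C" "b \<in> topspace (Euclidean_space n)" "\<psi> (b, c) \<in> int_top S interior_of window S i"
  shows "b \<in> Euclidean_space n interior_of slice i c"
proof -
  let ?V = "{b \<in> topspace (Euclidean_space n). \<psi> (b, c) \<in> int_top S interior_of window S i}"
  have "openin (Euclidean_space n) ?V"
    by (rule openin_continuous_map_preimage[OF \<psi>_slice_cont[OF assms(1)] openin_interior_of])
  moreover have "?V \<subseteq> slice i c"
    using interior_of_subset[of "int_top S" "window S i"] assms(1) by (auto simp: slice_def)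
  ultimately have "?V \<subseteq> Euclidean_space n interior_of slice i c" by (intro interior_of_maximal)
  then show ?thesis using assms by blast
qed

text \<open>The slice is a closed part of the image of the compact window in R^n.\<close>

lemma slice_compact:
  assumes "i \<in> colours S"
  shows "compactin (Euclidean_space n) (slice i c)"
proof (cases "c \<in> C")
  case True
  have "continuous_map (int_top S) (Euclidean_space n) (fst \<circ> \<phi>)"
    using \<phi>_cont unfolding model_space_eq by (rule continuous_map_compose) (rule continuous_map_fst)
  then have "compactin (Euclidean_space n) ((fst \<circ> \<phi>) ` window S i)"
    by (rule image_compactin[OF window_compact[OF assms]])
  moreover have "slice i c \<subseteq> (fst \<circ> \<phi>) ` window S i"
  proof
    fix b assume "b \<in> slice i c"
    then have "\<psi> (b, c) \<in> window S i" "\<phi> (\<psi> (b, c)) = (b, c)"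
      using \<phi>_\<psi> by (auto simp: slice_def)
    then show "b \<in> (fst \<circ> \<phi>) ` window S i" by (metis comp_apply fst_conv imageI)
  qed
  ultimately show ?thesis using slice_closed[OF assms True] by (rule closed_compactin)
qed (simp add: slice_def)

text \<open>A neighbourhood of \<open>b\<close>, placed over \<open>c\<close>, is open in the
  internal space. It therefore meets the interior of the window without leaving the component, and
  \<open>slice_interior\<close> brings the point found back to the slice.\<close>

lemma slice_regular:
  assumes "i \<in> colours S"
  shows "slice i c = Euclidean_space n closure_of (Euclidean_space n interior_of slice i c)"
proof (cases "c \<in> C")
  case True
  show ?thesis
  proof
    show "Euclidean_space n closure_of (Euclidean_space n interior_of slice i c) \<subseteq> slice i c"
      using slice_closed[OF assms True] by (intro closure_of_minimal interior_of_subset)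
    show "slice i c \<subseteq> Euclidean_space n closure_of (Euclidean_space n interior_of slice i c)"
    proof
      fix b assume b: "b \<in> slice i c"
      then have bE: "b \<in> topspace (Euclidean_space n)" "\<psi> (b, c) \<in> window S i" by (auto simp: slice_def)
      have "\<exists>y. y \<in> Euclidean_space n interior_of slice i c \<and> y \<in> O'"
        if O': "b \<in> O'" "openin (Euclidean_space n) O'" for O'
      proof -
        define V where "V = \<psi> ` (O' \<times> {c})"
        have "openin (int_top S) V" "\<psi> (b, c) \<in> V"
          unfolding V_def using openin_\<psi>_slice[OF True O'(2)] O'(1) by blast+
        moreover have "\<psi> (b, c) \<in> int_top S closure_of (int_top S interior_of window S i)"
          using bE(2) window_regular[OF assms] by metis
        ultimately have "\<exists>z. z \<in> int_top S interior_of window S i \<and> z \<in> V"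
          by (simp add: in_closure_of)
        then obtain z where z: "z \<in> int_top S interior_of window S i" "z \<in> V" by blast
        then obtain y where y: "y \<in> O'" "z = \<psi> (y, c)" unfolding V_def by blast
        then have "y \<in> topspace (Euclidean_space n)" using O'(2) openin_subset by blast
        then have "y \<in> Euclidean_space n interior_of slice i c"
          using slice_interior True z(1) y(2) by blast
        with y(1) show ?thesis by blast
      qed
      with bE(1) show "b \<in> Euclidean_space n closure_of (Euclidean_space n interior_of slice i c)"
        unfolding in_closure_of by blast
    qed
  qed
qed (simp add: slice_def)

section \<open>The lattice in coordinates\<close>

lemma mem_L:
  assumes "(a, b, c) \<in> L"
  obtains \<gamma> where "\<gamma> \<in> lattice S" "\<gamma> \<in> topspace (total S)" "a = coord S (proj_phys S \<gamma>)"
    "(b, c) = \<phi> (proj_int S \<gamma>)" "\<psi> (b, c) = proj_int S \<gamma>"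
    "a \<in> topspace (Euclidean_space d)" "b \<in> topspace (Euclidean_space n)" "c \<in> C" "\<gamma> = \<theta> (a, b, c)"
proof -
  obtain \<gamma> where g: "\<gamma> \<in> lattice S" "(a, b, c) = chart \<gamma>" using assms by (auto simp: L_def)
  then have gt: "\<gamma> \<in> topspace (total S)" using lattice_subset by blast
  have e: "a = coord S (proj_phys S \<gamma>)" "(b, c) = \<phi> (proj_int S \<gamma>)" using g(2) by (simp_all add: chart_def)
  have "\<psi> (b, c) = proj_int S \<gamma>" unfolding e(2) by (rule \<psi>_\<phi>[OF proj_decomposition(2)[OF gt]])
  moreover have "\<gamma> = \<theta> (a, b, c)" unfolding g(2) \<theta>_chart[OF gt] ..
  moreover have "a \<in> topspace (Euclidean_space d)" "b \<in> topspace (Euclidean_space n)" "c \<in> C"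
    using chart_in[OF gt] unfolding g(2)[symmetric] by auto
  ultimately show thesis using that g(1) gt e by blast
qed

text \<open>
  The topology of the total space is not assumed to be the product of those of the physical and
  internal spaces. A priori it is only coarser, but by Baire's theorem some compact box still has
  interior points.
\<close>

lemma L_cocompact:
  "\<exists>K F. compactin (prod_topology (Euclidean_space d) (Euclidean_space n)) K \<and> finite F \<and>
    (\<forall>a\<in>topspace (Euclidean_space d). \<forall>b\<in>topspace (Euclidean_space n).
       \<exists>a' b' c'. (a', b', c') \<in> L \<and> (a - a', b - b') \<in> K \<and> c' \<in> F)"
proof -
  let ?ES = "prod_topology (Euclidean_space d) (Euclidean_space n)"
  let ?B = "\<lambda>k (m::nat). {x \<in> topspace (Euclidean_space k). \<forall>i. \<bar>x i\<bar> \<le> real m}"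
  \<comment> \<open>Countably many compact images of boxes exhaust the total space: one family of
    growing boxes over each of the countably many components.\<close>
  define K0 where "K0 = (\<lambda>m c. \<theta> ` (?B d m \<times> ?B n m \<times> {c}))"
  define \<K> where "\<K> = (\<lambda>(m, c). K0 m c) ` (UNIV \<times> C)"
  have comp: "compactin (total S) (K0 m c)" if "c \<in> C" for m c
  proof -
    have "compactin (prod_topology (Euclidean_space d) M) (?B d m \<times> ?B n m \<times> {c})"
      using compactin_Euclidean_box[of d "real m"] compactin_Euclidean_box[of n "real m"] that
      unfolding model_space_eq by (simp add: compactin_Times)
    then show ?thesis unfolding K0_def by (rule image_compactin[OF _ \<theta>_cont])
  qed
  have Haus: "Hausdorff_space (total S)"
    using total_completely_metrizable completely_metrizable_imp_metrizable_space metrizable_imp_Hausdorff_space by blast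
  have bounded: "\<exists>m::nat. \<forall>i. \<bar>a i\<bar> \<le> real m" if a: "a \<in> topspace (Euclidean_space k)" for a k
  proof -
    have "\<bar>a i\<bar> \<le> (\<Sum>i<k. \<bar>a i\<bar>)" for i
    proof (cases "i < k")
      case True
      then show ?thesis by (intro member_le_sum) auto
    qed (use a in \<open>auto simp: topspace_Euclidean_space intro: sum_nonneg\<close>)
    moreover obtain m :: nat where "(\<Sum>i<k. \<bar>a i\<bar>) \<le> real m" using real_arch_simple by blast
    ultimately show ?thesis using order_trans by blast
  qed
  have "topspace (total S) \<subseteq> \<Union>\<K>"
  proof
    fix x assume x: "x \<in> topspace (total S)"
    obtain a b c where abc: "chart x = (a, b, c)" by (cases "chart x") auto
    then have in_E: "a \<in> topspace (Euclidean_space d)" "b \<in> topspace (Euclidean_space n)" "c \<in> C"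
      using chart_in[OF x] by auto
    obtain m1 m2 :: nat where m12: "\<forall>i. \<bar>a i\<bar> \<le> real m1" "\<forall>i. \<bar>b i\<bar> \<le> real m2"
      using bounded[OF in_E(1)] bounded[OF in_E(2)] by blast
    define m where "m = max m1 m2"
    have "real m1 \<le> real m" "real m2 \<le> real m" by (simp_all add: m_def)
    then have "\<forall>i. \<bar>a i\<bar> \<le> real m" "\<forall>i. \<bar>b i\<bar> \<le> real m"
      using m12 order_trans by blast+
    then have "(a, b, c) \<in> ?B d m \<times> ?B n m \<times> {c}" using in_E by blast
    moreover have "x = \<theta> (a, b, c)" using \<theta>_chart[OF x] abc by simp
    ultimately have "x \<in> K0 m c" unfolding K0_def by (rule_tac image_eqI)
    moreover have "K0 m c \<in> \<K>" using in_E(3) by (auto simp: \<K>_def)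
    ultimately show "x \<in> \<Union>\<K>" by blast
  qed
  then have "total S interior_of \<Union>\<K> = topspace (total S)"
    by (metis interior_of_mono interior_of_subset_topspace interior_of_topspace subset_antisym)
  moreover have "0 \<in> topspace (total S)" by (rule add_subgroupD(1)[OF total_subgroup])
  ultimately have "total S interior_of \<Union>\<K> \<noteq> {}" by blast
  moreover have "countable \<K>"
    using countable_discrete_part[OF G(1)] unfolding \<K>_def by (intro countable_image countable_SIGMA) auto
  moreover have "closedin (total S) T" if "T \<in> \<K>" for T
    using that comp compactin_imp_closedin[OF Haus] unfolding \<K>_def by auto
  \<comment> \<open>Contrapositive of Baire's theorem: a countable union of closed sets with empty
    interior would itself have empty interior.\<close>
  ultimately obtain T where "T \<in> \<K>" "total S interior_of T \<noteq> {}"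
    using Baire_category_alt[of "total S" \<K>] total_completely_metrizable by blast
  then obtain m c0 where c0: "c0 \<in> C" "total S interior_of K0 m c0 \<noteq> {}"
    unfolding \<K>_def by auto
  let ?\<Omega> = "total S interior_of K0 m c0"
  obtain Q where Q: "quotient_map (total S) Q (\<lambda>x. (\<lambda>\<gamma>. x + \<gamma>) ` lattice S)" "compact_space Q"
    using lattice_S unfolding discrete_cocompact_subgroup_def by blast
  obtain F where F: "finite F" "F \<subseteq> topspace (total S)"
    "\<And>x. x \<in> topspace (total S) \<Longrightarrow> \<exists>\<gamma>\<in>lattice S. \<exists>e\<in>F. \<exists>u\<in>?\<Omega>. x = \<gamma> + (u + e)"
    using cocompactD[OF total_group lattice_subgroup lattice_subset Q openin_interior_of c0(2)] by metis
  let ?e = "\<lambda>e. (fst (chart e), fst (snd (chart e)))"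
  let ?box = "?B d m \<times> ?B n m"
  define K where "K = (\<Union>e\<in>F. (\<lambda>p. p + ?e e) ` ?box)"
  have "compactin ?ES ((\<lambda>p. p + ?e e) ` ?box)" if "e \<in> F" for e
  proof (rule compactin_translation)
    show "topological_group_on ?ES"
      by (intro topological_group_on_prod topological_group_on_Euclidean_space)
    have "chart e \<in> topspace (Euclidean_space d) \<times> topspace (Euclidean_space n) \<times> C"
      using chart_in F(2) that by blast
    then show "?e e \<in> topspace ?ES" by (auto simp: mem_Times_iff)
    show "compactin ?ES ?box"
      using compactin_Euclidean_box by (simp add: compactin_Times)
  qed
  then have "compactin ?ES K"
    unfolding K_def using F(1) by (intro compactin_Union) auto
  \<comment> \<open>Write \<open>(a, b, 0)\<close> as the sum of the coordinates of \<gamma>,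
    \<open>u\<close> and \<open>e\<close>. As \<open>u\<close> lies over the single component
    \<open>c0\<close> and \<open>e\<close> over one of finitely many, the component of \<gamma>
    takes only finitely many values.\<close>
  moreover have "\<exists>a' b' c'. (a', b', c') \<in> L \<and> (a - a', b - b') \<in> K \<and> c' \<in> (\<lambda>e. - (c0 + snd (snd (chart e)))) ` F"
    if ab: "a \<in> topspace (Euclidean_space d)" "b \<in> topspace (Euclidean_space n)" for a b
  proof -
    have p: "(a, b, 0) \<in> topspace (Euclidean_space d) \<times> topspace (Euclidean_space n) \<times> C"
      using ab add_subgroupD(1)[OF C_group] by blast
    obtain \<gamma> e u where g: "\<gamma> \<in> lattice S" "e \<in> F" "u \<in> ?\<Omega>" "\<theta> (a, b, 0) = \<gamma> + (u + e)"
      using F(3)[OF \<theta>_in[OF p]] by blast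
    have "u \<in> K0 m c0" by (rule subsetD[OF interior_of_subset g(3)])
    then obtain ua ub where u: "ua \<in> ?B d m" "ub \<in> ?B n m" "u = \<theta> (ua, ub, c0)"
      unfolding K0_def by auto
    have chartu: "chart u = (ua, ub, c0)" unfolding u(3) using u(1,2) c0(1) by (intro chart_\<theta>) auto
    have tops: "\<gamma> \<in> topspace (total S)" "u \<in> topspace (total S)" "e \<in> topspace (total S)"
      by (rule subsetD[OF lattice_subset g(1)] subsetD[OF interior_of_subset_topspace g(3)]
          subsetD[OF F(2) g(2)])+
    have "(a, b, 0) = chart (\<theta> (a, b, 0))" using chart_\<theta>[OF p] by simp
    also have "\<dots> = chart \<gamma> + (chart u + chart e)"
      unfolding g(4) using tops add_subgroupD(2)[OF total_subgroup] by (simp add: chart_add)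
    finally have eq: "(a, b, 0) = chart \<gamma> + (chart u + chart e)" .
    obtain a' b' c' where chartg: "chart \<gamma> = (a', b', c')" by (cases "chart \<gamma>") auto
    obtain ea eb ec where charte: "chart e = (ea, eb, ec)" by (cases "chart e") auto
    have abc: "a = a' + (ua + ea)" "b = b' + (ub + eb)" "c' + (c0 + ec) = 0"
      using eq unfolding chartg chartu charte by simp_all
    then have "a - a' = ua + ea" "b - b' = ub + eb" by simp_all
    moreover have "c' = - (c0 + ec)" using abc(3) by (rule eq_neg_iff_add_eq_0[THEN iffD2])
    moreover have "(ua, ub) + ?e e \<in> K" unfolding K_def using u(1,2) g(2) by blast
    moreover have "(a', b', c') \<in> L" using g(1) chartg unfolding L_def by (metis imageI)
    ultimately show ?thesis
      using g(2) charte by (intro exI[of _ a'] exI[of _ b'] exI[of _ c']) (auto simp: image_iff intro!: bexI[of _ e])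
  qed
  ultimately show ?thesis
    using F(1) by (intro exI[of _ K] exI[of _ "(\<lambda>e. - (c0 + snd (snd (chart e)))) ` F"]) blast
qed

text \<open>A neighbourhood that isolates 0 in the lattice is pulled back along \<theta>, restricted
  to the component of 0. The other periods are treated in \<open>reduced_discrete\<close>.\<close>

lemma L_discrete:
  "\<exists>O'. openin (prod_topology (Euclidean_space d) (Euclidean_space n)) O' \<and> (0, 0) \<in> O' \<and>
     (\<forall>a b. (a, b, 0) \<in> L \<and> (a, b) \<in> O' \<longrightarrow> a = 0 \<and> b = 0)"
proof -
  let ?ES = "prod_topology (Euclidean_space d) (Euclidean_space n)"
  have "subtopology (total S) (lattice S) = discrete_topology (lattice S)"
    using lattice_S by (simp add: discrete_cocompact_subgroup_def)
  then obtain V where V: "openin (total S) V" "0 \<in> V" "V \<inter> lattice S \<subseteq> {0}"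
    unfolding discrete_subgroup_iff[OF total_group lattice_subgroup lattice_subset] by blast
  have "continuous_map ?ES (prod_topology (Euclidean_space d) M) (\<lambda>p. (fst p, snd p, 0))"
    unfolding model_space_eq using add_subgroupD(1)[OF C_group]
    by (intro continuous_map_pairedI continuous_map_fst continuous_map_snd) auto
  then have "continuous_map ?ES (total S) (\<lambda>p. \<theta> (fst p, snd p, 0))"
    using continuous_map_compose[OF _ \<theta>_cont] by (fastforce simp: o_def)
  then have "openin ?ES {p \<in> topspace ?ES. \<theta> (fst p, snd p, 0) \<in> V}"
    using V(1) by (rule openin_continuous_map_preimage)
  moreover have "\<theta> (0, 0, 0) = 0"
    using \<theta>_chart[OF add_subgroupD(1)[OF total_subgroup]] chart_0 by (simp add: zero_prod_def)
  then have "(0, 0) \<in> {p \<in> topspace ?ES. \<theta> (fst p, snd p, 0) \<in> V}"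
    using V(2) add_subgroupD(1)[OF add_subgroup_Euclidean_space[of d]]
      add_subgroupD(1)[OF add_subgroup_Euclidean_space[of n]] by simp
  moreover have "a = 0 \<and> b = 0"
    if ab: "(a, b, 0) \<in> L" "(a, b) \<in> {p \<in> topspace ?ES. \<theta> (fst p, snd p, 0) \<in> V}" for a b
  proof -
    obtain \<gamma> where g: "\<gamma> \<in> lattice S" "(a, b, 0) = chart \<gamma>" using ab(1) by (auto simp: L_def)
    have "\<theta> (a, b, 0) = \<gamma>" unfolding g(2) by (rule \<theta>_chart[OF subsetD[OF lattice_subset g(1)]])
    then have "\<gamma> \<in> V" using ab(2) by simp
    then have "\<gamma> = 0" using g(1) V(3) by blast
    then show ?thesis using g(2) chart_0 by (simp add: zero_prod_def)
  qed
  ultimately show ?thesis by blast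
qed

text \<open>As \<open>O'\<close> placed over \<open>c\<close> is open in the internal space, density
  of the projected lattice already gives density in every single component.\<close>

lemma L_dense:
  assumes "c \<in> C" "openin (Euclidean_space n) O'" "O' \<noteq> {}"
  shows "\<exists>a b. (a, b, c) \<in> L \<and> b \<in> O'"
proof -
  obtain b0 where b0: "b0 \<in> O'" using assms(3) by blast
  define V where "V = \<psi> ` (O' \<times> {c})"
  have V: "openin (int_top S) V" "\<psi> (b0, c) \<in> V"
    unfolding V_def using openin_\<psi>_slice[OF assms(1,2)] b0 by blast+
  have O_sub: "O' \<subseteq> topspace (Euclidean_space n)" using assms(2) by (rule openin_subset)
  have "\<psi> (b0, c) \<in> intern S" using b0 O_sub assms(1) by (intro \<psi>_in) blast
  then have "\<psi> (b0, c) \<in> int_top S closure_of (proj_int S ` lattice S)" by (simp add: dense)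
  then have "\<exists>y. y \<in> proj_int S ` lattice S \<and> y \<in> V" using V by (simp add: in_closure_of)
  then obtain \<gamma> b where g: "\<gamma> \<in> lattice S" "b \<in> O'" "proj_int S \<gamma> = \<psi> (b, c)"
    unfolding V_def by blast
  then have "\<phi> (proj_int S \<gamma>) = (b, c)" using \<phi>_\<psi>[of "(b, c)"] O_sub assms(1) by auto
  then have "chart \<gamma> = (coord S (proj_phys S \<gamma>), b, c)" by (simp add: chart_def)
  then have "(coord S (proj_phys S \<gamma>), b, c) \<in> L" using g(1) unfolding L_def by (metis imageI)
  with g(2) show ?thesis by blast
qed

lemma lattice_0: "0 \<in> lattice S"
  by (rule add_subgroupD(1)[OF lattice_subgroup])

lemma proj_0: "proj_phys S 0 = 0" "proj_int S 0 = 0"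
  using proj_sum[OF add_subgroupD(1)[OF phys_subgroup] add_subgroupD(1)[OF intern_subgroup]] by simp_all

lemma chart_0_components: "coord S 0 = 0" "\<phi> 0 = 0"
  using chart_0 unfolding chart_def proj_0 by (simp_all add: zero_prod_def)

lemma cut_project_set_eq:
  "cut_project_set S = {(a, i) | a b c i. (a, b, c) \<in> L \<and> i \<in> colours S \<and> b \<in> slice i c}"
proof -
  have "(x, i) \<in> cut_project_set S \<longleftrightarrow> (\<exists>b c. (x, b, c) \<in> L \<and> i \<in> colours S \<and> b \<in> slice i c)" for x i
  proof
    assume "(x, i) \<in> cut_project_set S"
    then obtain \<gamma> where g: "\<gamma> \<in> lattice S" "x = coord S (proj_phys S \<gamma>)" "i \<in> colours S" "proj_int S \<gamma> \<in> window S i"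
      by (auto simp: cut_project_set_def)
    obtain b c where bc: "\<phi> (proj_int S \<gamma>) = (b, c)" by (cases "\<phi> (proj_int S \<gamma>)") auto
    then have "chart \<gamma> = (x, b, c)" using g(2) by (simp add: chart_def)
    then have L: "(x, b, c) \<in> L" using g(1) unfolding L_def by (metis imageI)
    have "proj_int S \<gamma> \<in> intern S" by (rule proj_decomposition(2)[OF subsetD[OF lattice_subset g(1)]])
    then have "\<psi> (b, c) = proj_int S \<gamma>" "b \<in> topspace (Euclidean_space n)" "c \<in> C"
      using \<psi>_\<phi>[of "proj_int S \<gamma>"] \<phi>_in[of "proj_int S \<gamma>"] bc by auto
    then have "b \<in> slice i c" using g(4) by (simp add: slice_def)
    with L g(3) show "\<exists>b c. (x, b, c) \<in> L \<and> i \<in> colours S \<and> b \<in> slice i c" by blast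
  next
    assume "\<exists>b c. (x, b, c) \<in> L \<and> i \<in> colours S \<and> b \<in> slice i c"
    then obtain b c where bc: "(x, b, c) \<in> L" "i \<in> colours S" "b \<in> slice i c" by blast
    obtain \<gamma> where g: "\<gamma> \<in> lattice S" "x = coord S (proj_phys S \<gamma>)" "\<psi> (b, c) = proj_int S \<gamma>"
      using bc(1) by (rule mem_L)
    then have "proj_int S \<gamma> \<in> window S i" using bc(3) by (simp add: slice_def)
    then show "(x, i) \<in> cut_project_set S" using g(1,2) bc(2) unfolding cut_project_set_def by blast
  qed
  then show ?thesis
    unfolding set_eq_iff split_paired_All mem_Collect_eq by blast
qed

text \<open>The projection of a compact window to the discrete group \<open>C\<close> is compact,
  hence finite.\<close>

lemma finite_slices: "finite {c. \<exists>i\<in>colours S. slice i c \<noteq> {}}"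
proof (rule finite_subset)
  show "{c. \<exists>i\<in>colours S. slice i c \<noteq> {}} \<subseteq> (\<Union>i\<in>colours S. (snd \<circ> \<phi>) ` window S i)"
  proof
    fix c assume "c \<in> {c. \<exists>i\<in>colours S. slice i c \<noteq> {}}"
    then obtain i b where i: "i \<in> colours S" "b \<in> slice i c" by blast
    then have "\<psi> (b, c) \<in> window S i" "\<phi> (\<psi> (b, c)) = (b, c)"
      using \<phi>_\<psi>[of "(b, c)"] by (auto simp: slice_def)
    then have "c \<in> (snd \<circ> \<phi>) ` window S i" by (metis comp_apply snd_conv imageI)
    with i(1) show "c \<in> (\<Union>i\<in>colours S. (snd \<circ> \<phi>) ` window S i)" by blast
  qed
  have cont: "continuous_map (int_top S) (discrete_topology C) (snd \<circ> \<phi>)"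
    using \<phi>_cont unfolding model_space_eq by (rule continuous_map_compose) (rule continuous_map_snd)
  have "finite ((snd \<circ> \<phi>) ` window S i)" if "i \<in> colours S" for i
    using image_compactin[OF window_compact[OF that] cont] unfolding compactin_discrete_topology ..
  moreover have "finite (colours S)" using admissible by (simp add: admissible_window_def)
  ultimately show "finite (\<Union>i\<in>colours S. (snd \<circ> \<phi>) ` window S i)" by blast
qed

lemma exists_nonempty_slice: "\<exists>i\<in>colours S. \<exists>c. slice i c \<noteq> {}"
proof -
  have "(\<Union>i\<in>colours S. window S i) \<noteq> {}" using admissible by (simp add: admissible_window_def)
  then obtain i x where i: "i \<in> colours S" "x \<in> window S i" by blast
  then have x: "x \<in> intern S" using window_subset by blast
  obtain b c where bc: "\<phi> x = (b, c)" by (cases "\<phi> x") auto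
  then have "b \<in> slice i c"
    using \<psi>_\<phi>[OF x] \<phi>_in[OF x] i(2) by (simp add: slice_def)
  with i(1) show ?thesis by blast
qed

text \<open>By \<open>slice_interior\<close> a frontier point of a slice cannot be interior to the
  window, so it would be a frontier point of the window.\<close>

lemma slice_nonsingular:
  assumes "(a, b, c) \<in> L" "i \<in> colours S"
  shows "b \<notin> Euclidean_space n frontier_of slice i c"
proof
  assume fr: "b \<in> Euclidean_space n frontier_of slice i c"
  obtain \<gamma> where g: "\<gamma> \<in> lattice S" "\<psi> (b, c) = proj_int S \<gamma>" "b \<in> topspace (Euclidean_space n)" "c \<in> C"
    using assms(1) by (rule mem_L)
  have "b \<in> slice i c"
    using fr slice_closed[OF assms(2) g(4)] by (simp add: frontier_of_def closure_of_closedin)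
  then have w: "\<psi> (b, c) \<in> window S i" by (simp add: slice_def)
  have "b \<notin> Euclidean_space n interior_of slice i c" using fr by (simp add: frontier_of_def)
  then have "\<psi> (b, c) \<notin> int_top S interior_of window S i" using slice_interior g(3,4) by blast
  then have "\<psi> (b, c) \<in> int_top S frontier_of window S i"
    using w closure_of_closedin[OF window_closed[OF assms(2)]] by (simp add: frontier_of_def)
  then show False using nonsingular[OF g(1) assms(2)] g(2) by simp
qed

lemma sliced_scheme_slice: "sliced_scheme d n C L (colours S) slice"
proof
  show "add_subgroup C" by (rule C_group)
  show "add_subgroup L"
    unfolding L_def
    by (rule add_subgroup_image[OF lattice_subgroup]) (use chart_add lattice_subset in blast)
  show "L \<subseteq> topspace (Euclidean_space d) \<times> topspace (Euclidean_space n) \<times> C"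
    unfolding L_def by (rule image_subsetI) (rule chart_in[OF subsetD[OF lattice_subset]])
  show "b = 0 \<and> c = 0" if L: "(0, b, c) \<in> L" for b c
  proof -
    obtain \<gamma> where g: "\<gamma> \<in> lattice S" "\<gamma> \<in> topspace (total S)" "0 = coord S (proj_phys S \<gamma>)" "(b, c) = \<phi> (proj_int S \<gamma>)"
      using L by (rule mem_L)
    have "proj_phys S \<gamma> = \<sigma> (coord S (proj_phys S \<gamma>))"
      using \<sigma>_coord[OF proj_decomposition(1)[OF g(2)]] by simp
    also have "\<dots> = \<sigma> (coord S 0)" using g(3) chart_0_components(1) by simp
    also have "\<dots> = 0" by (rule \<sigma>_coord[OF add_subgroupD(1)[OF phys_subgroup]])
    finally have "proj_phys S \<gamma> = proj_phys S 0" by (simp add: proj_0)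
    then have "\<gamma> = 0" using inj_onD[OF inj_phys] g(1) lattice_0 by blast
    then show ?thesis using g(4) proj_0(2) chart_0_components(2) by (simp add: zero_prod_def)
  qed
  show "a = 0" if L: "(a, 0, 0) \<in> L" for a
  proof -
    obtain \<gamma> where g: "\<gamma> \<in> lattice S" "\<gamma> \<in> topspace (total S)" "a = coord S (proj_phys S \<gamma>)" "(0, 0) = \<phi> (proj_int S \<gamma>)"
      using L by (rule mem_L)
    have "proj_int S \<gamma> = \<psi> (\<phi> (proj_int S \<gamma>))"
      using \<psi>_\<phi>[OF proj_decomposition(2)[OF g(2)]] by simp
    also have "\<dots> = \<psi> (\<phi> 0)" using g(4) chart_0_components(2) by (simp add: zero_prod_def)
    also have "\<dots> = 0" by (rule \<psi>_\<phi>[OF add_subgroupD(1)[OF intern_subgroup]])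
    finally have "proj_int S \<gamma> = proj_int S 0" by (simp add: proj_0)
    then have "\<gamma> = 0" using inj_onD[OF inj_int] g(1) lattice_0 by blast
    then show ?thesis using g(3) proj_0(1) chart_0_components(1) by simp
  qed
  show "finite (colours S)" using admissible by (simp add: admissible_window_def)
  show "c \<in> C" if "slice i c \<noteq> {}" for i c using that by (auto simp: slice_def)
qed (rule L_dense L_discrete L_cocompact slice_compact slice_regular finite_slices
    exists_nonempty_slice slice_nonsingular; assumption)+

end

theorem corollary5p7:
  fixes S :: "('a::ab_group_add, 'c) cut_project"
    and G :: "'g::ab_group_add set"
    and d n r :: nat
  assumes "cut_project_scheme d n G r S"
  shows "\<exists>S' :: (nat \<Rightarrow> real, nat) cut_project.
           cut_project_scheme d n {0::int} 0 S' \<and>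
           MLD d (cut_project_set S) (cut_project_set S')"
proof -
  have "top_group_isomorphic (int_top S) (model_space n G r)"
    and phys: "top_group_iso (phys_top S) (Euclidean_space d) (coord S)"
    using assms unfolding cut_project_scheme_def by - (elim conjE, assumption)+
  then obtain \<phi> where int: "top_group_iso (int_top S) (model_space n G r) \<phi>"
    unfolding top_group_isomorphic_def by blast
  obtain \<psi> where \<psi>: "homeomorphic_maps (int_top S) (model_space n G r) \<phi> \<psi>"
    using int unfolding top_group_iso_def homeomorphic_map_maps by blast
  obtain \<sigma> where \<sigma>: "homeomorphic_maps (phys_top S) (Euclidean_space d) (coord S) \<sigma>"
    using phys unfolding top_group_iso_def homeomorphic_map_maps by blast
  have "\<phi> (x + y) = \<phi> x + \<phi> y" if "x \<in> topspace (int_top S)" "y \<in> topspace (int_top S)" for x y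
    using int that unfolding top_group_iso_def by blast
  then have ch: "charted_scheme d n G r S \<phi> \<psi> \<sigma>"
    using assms \<psi> \<sigma> by (intro charted_scheme.intro)
  show ?thesis
    unfolding charted_scheme.cut_project_set_eq[OF ch]
    by (rule sliced_scheme.exists_flat_scheme[OF charted_scheme.sliced_scheme_slice[OF ch]])
qed

end
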